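(* Let $k$ be a field and let $\alpha$ be an arbitrary $k$-algebra automorphism of $k[[X]]$. Then $\widehat{S}=k[[X]][\theta;\alpha]$ satisfies $(\diamond)$.
   Context: $k[[X]][\theta;\alpha]$ is the skew polynomial ring with $\theta r=\alpha(r)\theta$ for $r\in k[[X]]$. A Noetherian ring $A$ satisfies $(\diamond)$ if the injective hull of every simple right or left $A$-module is locally Artinian, meaning that each of its finitely generated submodules is Artinian. *)

theory Defs
  imports
    "HOL-Algebra.Module"
    "HOL-Computational_Algebra.Formal_Power_Series"
    "HOL-Computational_Algebra.Polynomial"
begin

section \<open>Modules over noncommutative rings\<close>

text \<open>
  The library locale for modules requires a commutative base ring. Its record type and its
  predicate \<^const>\<open>submodule\<close> do not, and are reused here.
\<close>

locale left_module = R?: ring R + M?: abelian_group M for R (structure) and M (structure) +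
  assumes smult_closed [simp, intro]:
      "\<lbrakk>a \<in> carrier R; x \<in> carrier M\<rbrakk> \<Longrightarrow> a \<odot>\<^bsub>M\<^esub> x \<in> carrier M"
    and smult_l_distr:
      "\<lbrakk>a \<in> carrier R; b \<in> carrier R; x \<in> carrier M\<rbrakk> \<Longrightarrow>
        (a \<oplus> b) \<odot>\<^bsub>M\<^esub> x = a \<odot>\<^bsub>M\<^esub> x \<oplus>\<^bsub>M\<^esub> b \<odot>\<^bsub>M\<^esub> x"
    and smult_r_distr:
      "\<lbrakk>a \<in> carrier R; x \<in> carrier M; y \<in> carrier M\<rbrakk> \<Longrightarrow>
        a \<odot>\<^bsub>M\<^esub> (x \<oplus>\<^bsub>M\<^esub> y) = a \<odot>\<^bsub>M\<^esub> x \<oplus>\<^bsub>M\<^esub> a \<odot>\<^bsub>M\<^esub> y"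
    and smult_assoc:
      "\<lbrakk>a \<in> carrier R; b \<in> carrier R; x \<in> carrier M\<rbrakk> \<Longrightarrow>
        (a \<otimes> b) \<odot>\<^bsub>M\<^esub> x = a \<odot>\<^bsub>M\<^esub> (b \<odot>\<^bsub>M\<^esub> x)"
    and smult_one [simp]:
      "x \<in> carrier M \<Longrightarrow> \<one> \<odot>\<^bsub>M\<^esub> x = x"

text \<open>Right modules over \<open>R\<close> are treated as left modules over the opposite ring.\<close>

definition opposite_ring :: "('a, 'c) ring_scheme \<Rightarrow> ('a, 'c) ring_scheme" where
  "opposite_ring R = R\<lparr>monoid.mult := \<lambda>x y. y \<otimes>\<^bsub>R\<^esub> x\<rparr>"

definition regular_module :: "('a, 'c) ring_scheme \<Rightarrow> ('a, 'a) module" where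
  "regular_module R = \<lparr>carrier = carrier R, monoid.mult = monoid.mult R, one = one R,
     zero = zero R, add = add R, module.smult = monoid.mult R\<rparr>"

definition module_hom ::
  "('a, 'c) ring_scheme \<Rightarrow> ('a, 'b) module \<Rightarrow> ('a, 'd) module \<Rightarrow> ('b \<Rightarrow> 'd) set" where
  "module_hom R M N = {f. f \<in> carrier M \<rightarrow> carrier N \<and>
     (\<forall>x\<in>carrier M. \<forall>y\<in>carrier M. f (x \<oplus>\<^bsub>M\<^esub> y) = f x \<oplus>\<^bsub>N\<^esub> f y) \<and>
     (\<forall>a\<in>carrier R. \<forall>x\<in>carrier M. f (a \<odot>\<^bsub>M\<^esub> x) = a \<odot>\<^bsub>N\<^esub> f x)}"

definition simple_module :: "('a, 'c) ring_scheme \<Rightarrow> ('a, 'b) module \<Rightarrow> bool" where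
  "simple_module R M \<longleftrightarrow> left_module R M \<and> carrier M \<noteq> {\<zero>\<^bsub>M\<^esub>} \<and>
     (\<forall>N. submodule N R M \<longrightarrow> N = {\<zero>\<^bsub>M\<^esub>} \<or> N = carrier M)"

definition noetherian_module :: "('a, 'c) ring_scheme \<Rightarrow> ('a, 'b) module \<Rightarrow> bool" where
  "noetherian_module R M \<longleftrightarrow> left_module R M \<and>
     (\<forall>N :: nat \<Rightarrow> 'b set. (\<forall>n. submodule (N n) R M) \<and> (\<forall>n. N n \<subseteq> N (Suc n)) \<longrightarrow>
       (\<exists>m. \<forall>n\<ge>m. N n = N m))"

definition artinian_module :: "('a, 'c) ring_scheme \<Rightarrow> ('a, 'b) module \<Rightarrow> bool" where
  "artinian_module R M \<longleftrightarrow> left_module R M \<and>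
     (\<forall>N :: nat \<Rightarrow> 'b set. (\<forall>n. submodule (N n) R M) \<and> (\<forall>n. N (Suc n) \<subseteq> N n) \<longrightarrow>
       (\<exists>m. \<forall>n\<ge>m. N n = N m))"

definition submodule_span ::
  "('a, 'c) ring_scheme \<Rightarrow> ('a, 'b) module \<Rightarrow> 'b set \<Rightarrow> 'b set" where
  "submodule_span R M S = \<Inter>{N. submodule N R M \<and> S \<subseteq> N}"

definition locally_artinian :: "('a, 'c) ring_scheme \<Rightarrow> ('a, 'b) module \<Rightarrow> bool" where
  "locally_artinian R M \<longleftrightarrow> left_module R M \<and>
     (\<forall>S. finite S \<and> S \<subseteq> carrier M \<longrightarrow>
       artinian_module R (M\<lparr>carrier := submodule_span R M S\<rparr>))"

definition noetherian_ring :: "('a, 'c) ring_scheme \<Rightarrow> bool" where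
  "noetherian_ring R \<longleftrightarrow> noetherian_module R (regular_module R) \<and>
     noetherian_module (opposite_ring R) (regular_module (opposite_ring R))"

lemma opposite_ring_simps [simp]:
  "carrier (opposite_ring R) = carrier R"
  "x \<otimes>\<^bsub>opposite_ring R\<^esub> y = y \<otimes>\<^bsub>R\<^esub> x"
  "\<one>\<^bsub>opposite_ring R\<^esub> = \<one>\<^bsub>R\<^esub>"
  "\<zero>\<^bsub>opposite_ring R\<^esub> = \<zero>\<^bsub>R\<^esub>"
  "x \<oplus>\<^bsub>opposite_ring R\<^esub> y = x \<oplus>\<^bsub>R\<^esub> y"
  by (simp_all add: opposite_ring_def)

lemma regular_module_simps [simp]:
  "carrier (regular_module R) = carrier R"
  "\<zero>\<^bsub>regular_module R\<^esub> = \<zero>\<^bsub>R\<^esub>"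
  "x \<oplus>\<^bsub>regular_module R\<^esub> y = x \<oplus>\<^bsub>R\<^esub> y"
  "a \<odot>\<^bsub>regular_module R\<^esub> y = a \<otimes>\<^bsub>R\<^esub> y"
  by (simp_all add: regular_module_def)

lemma ring_opposite_ring:
  assumes "ring R"
  shows "ring (opposite_ring R)"
proof -
  interpret ring R by fact
  have "abelian_group (opposite_ring R)"
    by (rule abelian_groupI) (auto simp: a_ac intro: bexI[of _ "\<ominus>\<^bsub>R\<^esub> _"] l_neg)
  moreover have "monoid (opposite_ring R)"
    by (rule monoidI) (auto simp: m_assoc)
  ultimately show ?thesis
    by (rule ringI) (auto simp: l_distr r_distr)
qed

lemma left_module_regular_module:
  assumes "ring R"
  shows "left_module R (regular_module R)"
proof -
  interpret ring R by fact
  have "abelian_group (regular_module R)"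
    by (rule abelian_groupI) (auto simp: a_ac intro: bexI[of _ "\<ominus>\<^bsub>R\<^esub> _"] l_neg)
  then show ?thesis
    by (intro left_module.intro left_module_axioms.intro)
      (auto simp: assms l_distr r_distr m_assoc)
qed


context left_module
begin

lemma smult_l_null [simp]:
  assumes "x \<in> carrier M"
  shows "\<zero> \<odot>\<^bsub>M\<^esub> x = \<zero>\<^bsub>M\<^esub>"
  using smult_l_distr[of \<zero> \<zero> x] assms by (simp add: M.add.r_cancel_one')

lemma smult_r_null [simp]:
  assumes "a \<in> carrier R"
  shows "a \<odot>\<^bsub>M\<^esub> \<zero>\<^bsub>M\<^esub> = \<zero>\<^bsub>M\<^esub>"
  using smult_r_distr[of a "\<zero>\<^bsub>M\<^esub>" "\<zero>\<^bsub>M\<^esub>"] assms by (simp add: M.add.r_cancel_one')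

lemma smult_minus_one:
  assumes "x \<in> carrier M"
  shows "(\<ominus> \<one>) \<odot>\<^bsub>M\<^esub> x = \<ominus>\<^bsub>M\<^esub> x"
proof -
  have "(\<ominus> \<one>) \<odot>\<^bsub>M\<^esub> x \<oplus>\<^bsub>M\<^esub> x = (\<ominus> \<one> \<oplus> \<one>) \<odot>\<^bsub>M\<^esub> x"
    using assms by (simp add: smult_l_distr)
  also have "\<dots> = \<zero>\<^bsub>M\<^esub>" using assms by (simp add: R.l_neg)
  finally show ?thesis using assms by (simp add: M.minus_equality)
qed

lemma submodule_left_moduleI:
  assumes H: "H \<subseteq> carrier M" "\<zero>\<^bsub>M\<^esub> \<in> H"
    and add: "\<And>x y. \<lbrakk>x \<in> H; y \<in> H\<rbrakk> \<Longrightarrow> x \<oplus>\<^bsub>M\<^esub> y \<in> H"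
    and smult: "\<And>a x. \<lbrakk>a \<in> carrier R; x \<in> H\<rbrakk> \<Longrightarrow> a \<odot>\<^bsub>M\<^esub> x \<in> H"
  shows "left_module R (M\<lparr>carrier := H\<rparr>)"
proof -
  have sub: "x \<in> carrier M" if "x \<in> H" for x using H that by blast
  have "abelian_group (M\<lparr>carrier := H\<rparr>)"
  proof (rule abelian_groupI)
    fix x assume "x \<in> carrier (M\<lparr>carrier := H\<rparr>)"
    then have x: "x \<in> H" by simp
    then have "(\<ominus> \<one>) \<odot>\<^bsub>M\<^esub> x \<in> H" by (intro smult) auto
    then have "\<ominus>\<^bsub>M\<^esub> x \<in> H" using sub[OF x] by (simp add: smult_minus_one)
    then show "\<exists>y\<in>carrier (M\<lparr>carrier := H\<rparr>). y \<oplus>\<^bsub>M\<lparr>carrier := H\<rparr>\<^esub> x = \<zero>\<^bsub>M\<lparr>carrier := H\<rparr>\<^esub>"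
      using sub[OF x] by (auto intro!: bexI[of _ "\<ominus>\<^bsub>M\<^esub> x"] M.l_neg)
  qed (use H add sub in \<open>auto simp: M.a_ac\<close>)
  then show ?thesis
    by (intro left_module.intro left_module_axioms.intro R.ring_axioms)
      (auto simp: smult sub smult_l_distr smult_r_distr smult_assoc)
qed

end


section \<open>Injective modules and injective hulls\<close>

text \<open>
  The definition of an injective module quantifies over all pairs of modules, which cannot range
  over all types inside a formula. The test modules are therefore taken on the element type
  \<open>'a\<close> of the ring. By Baer's argument, this already gives the extension property for
  modules on every type; this is proved in \<open>injective_module_extends\<close> below.
\<close>

definition injective_module :: "('a, 'c) ring_scheme \<Rightarrow> ('a, 'e) module \<Rightarrow> bool" where
  "injective_module R E \<longleftrightarrow> left_module R E \<and>
     (\<forall>(A :: ('a, 'a) module) (B :: ('a, 'a) module) f g.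
        left_module R A \<and> left_module R B \<and>
        f \<in> module_hom R A B \<and> inj_on f (carrier A) \<and> g \<in> module_hom R A E \<longrightarrow>
        (\<exists>h \<in> module_hom R B E. \<forall>x\<in>carrier A. h (f x) = g x))"

theorem injective_module_extends:
  fixes R :: "('a, 'c) ring_scheme" and E :: "('a, 'e) module"
    and A :: "('a, 'b) module" and B :: "('a, 'd) module"
  assumes inj: "injective_module R E" and A: "left_module R A" and B: "left_module R B"
    and f: "f \<in> module_hom R A B" "inj_on f (carrier A)" and g: "g \<in> module_hom R A E"
  shows "\<exists>h \<in> module_hom R B E. \<forall>x\<in>carrier A. h (f x) = g x"
proof -
  interpret E: left_module R E using inj by (simp add: injective_module_def)
  interpret A: left_module R A by fact
  interpret B: left_module R B by fact
  define P where "P G \<longleftrightarrow> G \<subseteq> carrier B \<times> carrier E \<and> (\<lambda>x. (f x, g x)) ` carrier A \<subseteq> G \<and>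
    (\<forall>b e b' e'. (b, e) \<in> G \<and> (b', e') \<in> G \<longrightarrow> (b \<oplus>\<^bsub>B\<^esub> b', e \<oplus>\<^bsub>E\<^esub> e') \<in> G) \<and>
    (\<forall>r\<in>carrier R. \<forall>b e. (b, e) \<in> G \<longrightarrow> (r \<odot>\<^bsub>B\<^esub> b, r \<odot>\<^bsub>E\<^esub> e) \<in> G) \<and>
    (\<forall>b e e'. (b, e) \<in> G \<and> (b, e') \<in> G \<longrightarrow> e = e')" for G
  have fc: "f x \<in> carrier B" and gc: "g x \<in> carrier E" if "x \<in> carrier A" for x
    using that f g by (auto simp: module_hom_def)
  have fa: "f (x \<oplus>\<^bsub>A\<^esub> y) = f x \<oplus>\<^bsub>B\<^esub> f y" "g (x \<oplus>\<^bsub>A\<^esub> y) = g x \<oplus>\<^bsub>E\<^esub> g y"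
    if "x \<in> carrier A" "y \<in> carrier A" for x y
    using that f g by (auto simp: module_hom_def)
  have fs: "f (a \<odot>\<^bsub>A\<^esub> x) = a \<odot>\<^bsub>B\<^esub> f x" "g (a \<odot>\<^bsub>A\<^esub> x) = a \<odot>\<^bsub>E\<^esub> g x"
    if "a \<in> carrier R" "x \<in> carrier A" for a x
    using that f g by (auto simp: module_hom_def)
  have P0: "P ((\<lambda>x. (f x, g x)) ` carrier A)"
    unfolding P_def
  proof (intro conjI allI ballI impI)
    fix b e b' e'
    assume "(b, e) \<in> (\<lambda>x. (f x, g x)) ` carrier A \<and> (b', e') \<in> (\<lambda>x. (f x, g x)) ` carrier A"
    then obtain x y where "x \<in> carrier A" "y \<in> carrier A" "b = f x" "e = g x" "b' = f y" "e' = g y"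
      by auto
    then show "(b \<oplus>\<^bsub>B\<^esub> b', e \<oplus>\<^bsub>E\<^esub> e') \<in> (\<lambda>x. (f x, g x)) ` carrier A"
      by (auto intro!: image_eqI[of _ _ "x \<oplus>\<^bsub>A\<^esub> y"] simp: fa)
  next
    fix r b e assume r: "r \<in> carrier R" and "(b, e) \<in> (\<lambda>x. (f x, g x)) ` carrier A"
    then obtain x where "x \<in> carrier A" "b = f x" "e = g x" by auto
    with r show "(r \<odot>\<^bsub>B\<^esub> b, r \<odot>\<^bsub>E\<^esub> e) \<in> (\<lambda>x. (f x, g x)) ` carrier A"
      by (auto intro!: image_eqI[of _ _ "r \<odot>\<^bsub>A\<^esub> x"] simp: fs)
  qed (use f(2) fc gc in \<open>auto dest: inj_onD\<close>)
  have "\<exists>G\<in>Collect P. \<forall>X\<in>Collect P. G \<subseteq> X \<longrightarrow> X = G"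
  proof (rule subset_Zorn)
    fix C assume C: "subset.chain (Collect P) C"
    show "\<exists>U\<in>Collect P. \<forall>X\<in>C. X \<subseteq> U"
    proof (cases "C = {}")
      case True
      then show ?thesis using P0 by auto
    next
      case False
      have PX: "P X" if "X \<in> C" for X using that C by (auto simp: subset.chain_def)
      have two: "\<exists>X\<in>C. p \<in> X \<and> q \<in> X" if "p \<in> \<Union>C" "q \<in> \<Union>C" for p q
        using that C unfolding subset_chain_def by blast
      have "P (\<Union>C)"
        unfolding P_def
      proof (intro conjI allI ballI impI)
        show "\<Union>C \<subseteq> carrier B \<times> carrier E" using PX unfolding P_def by blast
        show "(\<lambda>x. (f x, g x)) ` carrier A \<subseteq> \<Union>C" using PX False unfolding P_def by blast
      next
        fix b e b' e' assume "(b, e) \<in> \<Union>C \<and> (b', e') \<in> \<Union>C"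
        then obtain X where X: "X \<in> C" "(b, e) \<in> X" "(b', e') \<in> X" using two by blast
        then have "(b \<oplus>\<^bsub>B\<^esub> b', e \<oplus>\<^bsub>E\<^esub> e') \<in> X" using PX[OF X(1)] unfolding P_def by blast
        then show "(b \<oplus>\<^bsub>B\<^esub> b', e \<oplus>\<^bsub>E\<^esub> e') \<in> \<Union>C" using X by blast
      next
        fix r b e assume r: "r \<in> carrier R" and "(b, e) \<in> \<Union>C"
        then obtain X where X: "X \<in> C" "(b, e) \<in> X" by blast
        then have "(r \<odot>\<^bsub>B\<^esub> b, r \<odot>\<^bsub>E\<^esub> e) \<in> X" using r PX[OF X(1)] unfolding P_def by blast
        then show "(r \<odot>\<^bsub>B\<^esub> b, r \<odot>\<^bsub>E\<^esub> e) \<in> \<Union>C" using X by blast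
      next
        fix b e e' assume "(b, e) \<in> \<Union>C \<and> (b, e') \<in> \<Union>C"
        then obtain X where X: "X \<in> C" "(b, e) \<in> X" "(b, e') \<in> X" using two by blast
        then show "e = e'" using PX[OF X(1)] unfolding P_def by blast
      qed
      then show ?thesis by auto
    qed
  qed
  then obtain G where PG: "P G" and max: "\<And>X. P X \<Longrightarrow> G \<subseteq> X \<Longrightarrow> X = G" by auto
  have Gsub: "b \<in> carrier B" "e \<in> carrier E" if "(b, e) \<in> G" for b e
    using PG that unfolding P_def by blast+
  have Gin: "(f x, g x) \<in> G" if "x \<in> carrier A" for x
    using PG that unfolding P_def by blast
  have Gadd: "(b \<oplus>\<^bsub>B\<^esub> b', e \<oplus>\<^bsub>E\<^esub> e') \<in> G" if "(b, e) \<in> G" "(b', e') \<in> G" for b e b' e'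
    using PG that unfolding P_def by blast
  have Gsm: "(r \<odot>\<^bsub>B\<^esub> b, r \<odot>\<^bsub>E\<^esub> e) \<in> G" if "r \<in> carrier R" "(b, e) \<in> G" for r b e
    using PG that unfolding P_def by blast
  have Gfun: "e = e'" if "(b, e) \<in> G" "(b, e') \<in> G" for b e e'
    using PG that unfolding P_def by blast
  have G0: "(\<zero>\<^bsub>B\<^esub>, \<zero>\<^bsub>E\<^esub>) \<in> G"
    using Gsm[OF E.R.zero_closed Gin[OF A.M.zero_closed]] fc gc by simp
  have total: "\<exists>e. (b, e) \<in> G" if b: "b \<in> carrier B" for b
  proof -
    define I where "I = {r \<in> carrier R. \<exists>e. (r \<odot>\<^bsub>B\<^esub> b, e) \<in> G}"
    define \<phi> where "\<phi> r = (THE e. (r \<odot>\<^bsub>B\<^esub> b, e) \<in> G)" for r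
    have \<phi>: "\<phi> r = e" if "(r \<odot>\<^bsub>B\<^esub> b, e) \<in> G" for r e
      unfolding \<phi>_def using that Gfun by blast
    have \<phi>G: "(r \<odot>\<^bsub>B\<^esub> b, \<phi> r) \<in> G" if "r \<in> I" for r
      using that \<phi> unfolding I_def by blast
    interpret RR: left_module R "regular_module R"
      by (rule left_module_regular_module) (rule E.R.ring_axioms)
    have Iadd: "(r \<oplus>\<^bsub>R\<^esub> s) \<odot>\<^bsub>B\<^esub> b = r \<odot>\<^bsub>B\<^esub> b \<oplus>\<^bsub>B\<^esub> s \<odot>\<^bsub>B\<^esub> b"
      if "r \<in> carrier R" "s \<in> carrier R" for r s using that b by (rule B.smult_l_distr)
    have addG: "((r \<oplus>\<^bsub>R\<^esub> s) \<odot>\<^bsub>B\<^esub> b, \<phi> r \<oplus>\<^bsub>E\<^esub> \<phi> s) \<in> G" if "r \<in> I" "s \<in> I" for r s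
      using Gadd[OF \<phi>G[OF that(1)] \<phi>G[OF that(2)]] that b by (simp add: Iadd I_def)
    have smG: "((a \<otimes>\<^bsub>R\<^esub> s) \<odot>\<^bsub>B\<^esub> b, a \<odot>\<^bsub>E\<^esub> \<phi> s) \<in> G" if "a \<in> carrier R" "s \<in> I" for a s
      using Gsm[OF that(1) \<phi>G[OF that(2)]] that b by (simp add: B.smult_assoc I_def)
    have Iadd': "r \<oplus>\<^bsub>R\<^esub> s \<in> I" if "r \<in> I" "s \<in> I" for r s
      using addG[OF that] that by (auto simp: I_def)
    have Ism: "a \<otimes>\<^bsub>R\<^esub> s \<in> I" if "a \<in> carrier R" "s \<in> I" for a s
      using smG[OF that] that by (auto simp: I_def)
    define J where "J = (regular_module R)\<lparr>carrier := I\<rparr>"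
    have J: "left_module R J"
      unfolding J_def
    proof (rule RR.submodule_left_moduleI)
      show "\<zero>\<^bsub>regular_module R\<^esub> \<in> I" using b G0 by (auto simp: I_def)
    qed (use Iadd' Ism in \<open>auto simp: I_def\<close>)
    have id: "(\<lambda>r. r) \<in> module_hom R J (regular_module R)"
      by (auto simp: module_hom_def J_def I_def)
    have \<phi>h: "\<phi> \<in> module_hom R J E"
      using \<phi>[OF addG] \<phi>[OF smG] Gsub(2)[OF \<phi>G] by (auto simp: module_hom_def J_def)
    obtain h where h: "h \<in> module_hom R (regular_module R) E" "\<And>r. r \<in> I \<Longrightarrow> h r = \<phi> r"
      using inj J RR.left_module_axioms id \<phi>h unfolding injective_module_def
      by (metis J_def inj_on_id2 partial_object.select_convs(1) partial_object.update_convs(1) partial_object.surjective)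
    define e where "e = h \<one>\<^bsub>R\<^esub>"
    have e: "e \<in> carrier E" using h(1) by (auto simp: module_hom_def e_def)
    have hr: "h r = r \<odot>\<^bsub>E\<^esub> e" if "r \<in> carrier R" for r
    proof -
      have "h (r \<otimes>\<^bsub>R\<^esub> \<one>\<^bsub>R\<^esub>) = r \<odot>\<^bsub>E\<^esub> h \<one>\<^bsub>R\<^esub>"
        using h(1) that by (simp add: module_hom_def del: E.R.r_one)
      then show ?thesis using that by (simp add: e_def)
    qed
    have key: "(r \<odot>\<^bsub>B\<^esub> b, y) \<in> G \<Longrightarrow> y = r \<odot>\<^bsub>E\<^esub> e" if "r \<in> carrier R" for r y
      using h(2)[of r] hr[of r] \<phi>[of r y] that unfolding I_def by force
    define G' where "G' = {(d \<oplus>\<^bsub>B\<^esub> r \<odot>\<^bsub>B\<^esub> b, y \<oplus>\<^bsub>E\<^esub> r \<odot>\<^bsub>E\<^esub> e) | d y r. (d, y) \<in> G \<and> r \<in> carrier R}"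
    have G'I: "(d \<oplus>\<^bsub>B\<^esub> r \<odot>\<^bsub>B\<^esub> b, y \<oplus>\<^bsub>E\<^esub> r \<odot>\<^bsub>E\<^esub> e) \<in> G'" if "(d, y) \<in> G" "r \<in> carrier R" for d y r
      using that unfolding G'_def by blast
    have GG': "G \<subseteq> G'"
    proof
      fix p assume "p \<in> G"
      then obtain d y where p: "p = (d, y)" "(d, y) \<in> G" by (cases p) auto
      show "p \<in> G'" using G'I[OF p(2) E.R.zero_closed] p Gsub[OF p(2)] b e by simp
    qed
    have "P G'"
      unfolding P_def
    proof (intro conjI allI ballI impI)
      show "G' \<subseteq> carrier B \<times> carrier E" using Gsub b e unfolding G'_def by auto
      show "(\<lambda>x. (f x, g x)) ` carrier A \<subseteq> G'" using Gin GG' by blast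
    next
      fix c y c' y' assume "(c, y) \<in> G' \<and> (c', y') \<in> G'"
      then obtain d r d' r' z z' where
        *: "(d, z) \<in> G" "r \<in> carrier R" "c = d \<oplus>\<^bsub>B\<^esub> r \<odot>\<^bsub>B\<^esub> b" "y = z \<oplus>\<^bsub>E\<^esub> r \<odot>\<^bsub>E\<^esub> e"
        "(d', z') \<in> G" "r' \<in> carrier R" "c' = d' \<oplus>\<^bsub>B\<^esub> r' \<odot>\<^bsub>B\<^esub> b" "y' = z' \<oplus>\<^bsub>E\<^esub> r' \<odot>\<^bsub>E\<^esub> e"
        unfolding G'_def by blast
      have "c \<oplus>\<^bsub>B\<^esub> c' = (d \<oplus>\<^bsub>B\<^esub> d') \<oplus>\<^bsub>B\<^esub> (r \<oplus>\<^bsub>R\<^esub> r') \<odot>\<^bsub>B\<^esub> b"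
        using * Gsub b by (simp add: B.smult_l_distr B.M.a_ac)
      moreover have "y \<oplus>\<^bsub>E\<^esub> y' = (z \<oplus>\<^bsub>E\<^esub> z') \<oplus>\<^bsub>E\<^esub> (r \<oplus>\<^bsub>R\<^esub> r') \<odot>\<^bsub>E\<^esub> e"
        using * Gsub e by (simp add: E.smult_l_distr E.M.a_ac)
      ultimately show "(c \<oplus>\<^bsub>B\<^esub> c', y \<oplus>\<^bsub>E\<^esub> y') \<in> G'"
        using G'I[OF Gadd[OF *(1) *(5)]] * by simp
    next
      fix a c y assume a: "a \<in> carrier R" and "(c, y) \<in> G'"
      then obtain d r z where
        *: "(d, z) \<in> G" "r \<in> carrier R" "c = d \<oplus>\<^bsub>B\<^esub> r \<odot>\<^bsub>B\<^esub> b" "y = z \<oplus>\<^bsub>E\<^esub> r \<odot>\<^bsub>E\<^esub> e"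
        unfolding G'_def by blast
      have "a \<odot>\<^bsub>B\<^esub> c = a \<odot>\<^bsub>B\<^esub> d \<oplus>\<^bsub>B\<^esub> (a \<otimes>\<^bsub>R\<^esub> r) \<odot>\<^bsub>B\<^esub> b"
        "a \<odot>\<^bsub>E\<^esub> y = a \<odot>\<^bsub>E\<^esub> z \<oplus>\<^bsub>E\<^esub> (a \<otimes>\<^bsub>R\<^esub> r) \<odot>\<^bsub>E\<^esub> e"
        using * a Gsub[OF *(1)] b e
        by (simp_all add: B.smult_r_distr B.smult_assoc E.smult_r_distr E.smult_assoc)
      then show "(a \<odot>\<^bsub>B\<^esub> c, a \<odot>\<^bsub>E\<^esub> y) \<in> G'"
        using G'I[OF Gsm[OF a *(1)]] * a by simp
    next
      fix c y y' assume "(c, y) \<in> G' \<and> (c, y') \<in> G'"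
      then obtain d r d' r' z z' where
        *: "(d, z) \<in> G" "r \<in> carrier R" "c = d \<oplus>\<^bsub>B\<^esub> r \<odot>\<^bsub>B\<^esub> b" "y = z \<oplus>\<^bsub>E\<^esub> r \<odot>\<^bsub>E\<^esub> e"
        "(d', z') \<in> G" "r' \<in> carrier R" "c = d' \<oplus>\<^bsub>B\<^esub> r' \<odot>\<^bsub>B\<^esub> b" "y' = z' \<oplus>\<^bsub>E\<^esub> r' \<odot>\<^bsub>E\<^esub> e"
        unfolding G'_def by blast
      note cl = Gsub[OF *(1)] Gsub[OF *(5)] *(2,6) b e
      let ?m = "\<ominus>\<^bsub>R\<^esub> \<one>\<^bsub>R\<^esub>"
      have neg: "?m \<otimes>\<^bsub>R\<^esub> r' = \<ominus>\<^bsub>R\<^esub> r'" using cl by (simp add: E.R.l_minus)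
      have nb: "(\<ominus>\<^bsub>R\<^esub> r') \<odot>\<^bsub>B\<^esub> b = \<ominus>\<^bsub>B\<^esub> (r' \<odot>\<^bsub>B\<^esub> b)"
        using cl by (simp add: B.smult_assoc B.smult_minus_one flip: neg)
      have ne: "(\<ominus>\<^bsub>R\<^esub> r') \<odot>\<^bsub>E\<^esub> e = \<ominus>\<^bsub>E\<^esub> (r' \<odot>\<^bsub>E\<^esub> e)"
        using cl by (simp add: E.smult_assoc E.smult_minus_one flip: neg)
      have "(?m \<odot>\<^bsub>B\<^esub> d, ?m \<odot>\<^bsub>E\<^esub> z) \<in> G" using Gsm[OF _ *(1)] by simp
      then have "(\<ominus>\<^bsub>B\<^esub> d, \<ominus>\<^bsub>E\<^esub> z) \<in> G" using cl by (simp add: B.smult_minus_one E.smult_minus_one)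
      then have dd: "(\<ominus>\<^bsub>B\<^esub> d \<oplus>\<^bsub>B\<^esub> d', \<ominus>\<^bsub>E\<^esub> z \<oplus>\<^bsub>E\<^esub> z') \<in> G" by (rule Gadd[OF _ *(5)])
      have cc: "d \<oplus>\<^bsub>B\<^esub> r \<odot>\<^bsub>B\<^esub> b = d' \<oplus>\<^bsub>B\<^esub> r' \<odot>\<^bsub>B\<^esub> b" using * by simp
      have "(r \<oplus>\<^bsub>R\<^esub> \<ominus>\<^bsub>R\<^esub> r') \<odot>\<^bsub>B\<^esub> b = r \<odot>\<^bsub>B\<^esub> b \<oplus>\<^bsub>B\<^esub> \<ominus>\<^bsub>B\<^esub> (r' \<odot>\<^bsub>B\<^esub> b)"
        using cl by (simp add: B.smult_l_distr nb)
      also have "\<dots> = \<ominus>\<^bsub>B\<^esub> d \<oplus>\<^bsub>B\<^esub> (d \<oplus>\<^bsub>B\<^esub> r \<odot>\<^bsub>B\<^esub> b) \<oplus>\<^bsub>B\<^esub> \<ominus>\<^bsub>B\<^esub> (r' \<odot>\<^bsub>B\<^esub> b)"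
        using cl by (simp add: B.M.r_neg1)
      also have "\<dots> = \<ominus>\<^bsub>B\<^esub> d \<oplus>\<^bsub>B\<^esub> d'"
        unfolding cc using cl by (simp add: B.M.a_assoc B.M.r_neg)
      finally have "\<ominus>\<^bsub>E\<^esub> z \<oplus>\<^bsub>E\<^esub> z' = (r \<oplus>\<^bsub>R\<^esub> \<ominus>\<^bsub>R\<^esub> r') \<odot>\<^bsub>E\<^esub> e"
        using key[of "r \<oplus>\<^bsub>R\<^esub> \<ominus>\<^bsub>R\<^esub> r'"] dd cl by simp
      also have "\<dots> = r \<odot>\<^bsub>E\<^esub> e \<oplus>\<^bsub>E\<^esub> \<ominus>\<^bsub>E\<^esub> (r' \<odot>\<^bsub>E\<^esub> e)"
        using cl by (simp add: E.smult_l_distr ne)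
      finally have zz: "\<ominus>\<^bsub>E\<^esub> z \<oplus>\<^bsub>E\<^esub> z' = r \<odot>\<^bsub>E\<^esub> e \<oplus>\<^bsub>E\<^esub> \<ominus>\<^bsub>E\<^esub> (r' \<odot>\<^bsub>E\<^esub> e)" .
      have "y' = z \<oplus>\<^bsub>E\<^esub> (\<ominus>\<^bsub>E\<^esub> z \<oplus>\<^bsub>E\<^esub> z') \<oplus>\<^bsub>E\<^esub> r' \<odot>\<^bsub>E\<^esub> e"
        using cl * by (simp add: E.M.r_neg2)
      also have "\<dots> = y"
        unfolding zz using cl * by (simp add: E.M.a_assoc E.M.l_neg)
      finally show "y = y'" by simp
    qed
    then have "G' = G" using max GG' by blast
    moreover have "(\<zero>\<^bsub>B\<^esub> \<oplus>\<^bsub>B\<^esub> \<one>\<^bsub>R\<^esub> \<odot>\<^bsub>B\<^esub> b, \<zero>\<^bsub>E\<^esub> \<oplus>\<^bsub>E\<^esub> \<one>\<^bsub>R\<^esub> \<odot>\<^bsub>E\<^esub> e) \<in> G'"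
      by (rule G'I[OF G0]) simp
    ultimately show ?thesis using b e by auto
  qed
  define h where "h b = (THE e. (b, e) \<in> G)" for b
  have h: "h b = e" if "(b, e) \<in> G" for b e
    unfolding h_def using that Gfun by blast
  have hG: "(b, h b) \<in> G" if "b \<in> carrier B" for b
    using total[OF that] h by blast
  have "h \<in> module_hom R B E"
    unfolding module_hom_def using Gsub(2)[OF hG] h[OF Gadd[OF hG hG]] h[OF Gsm[OF _ hG]] by auto
  moreover have "\<forall>x\<in>carrier A. h (f x) = g x" using h[OF Gin] by blast
  ultimately show ?thesis by blast
qed

definition essential_submodule ::
  "('a, 'c) ring_scheme \<Rightarrow> ('a, 'b) module \<Rightarrow> 'b set \<Rightarrow> bool" where
  "essential_submodule R E U \<longleftrightarrow> submodule U R E \<and>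
     (\<forall>N. submodule N R E \<and> N \<noteq> {\<zero>\<^bsub>E\<^esub>} \<longrightarrow> U \<inter> N \<noteq> {\<zero>\<^bsub>E\<^esub>})"

definition injective_hull ::
  "('a, 'c) ring_scheme \<Rightarrow> ('a, 'm) module \<Rightarrow> ('a, 'e) module \<Rightarrow> ('m \<Rightarrow> 'e) \<Rightarrow> bool" where
  "injective_hull R M E \<iota> \<longleftrightarrow> left_module R M \<and> injective_module R E \<and>
     \<iota> \<in> module_hom R M E \<and> inj_on \<iota> (carrier M) \<and> essential_submodule R E (\<iota> ` carrier M)"

text \<open>
  The arguments of type \<open>itself\<close> give the element types of the simple modules and of their
  injective hulls. A theorem that leaves both types as type variables covers simple modules and
  hulls on all types. Injective hulls are unique up to isomorphism, so the property is stated
  for every hull.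
\<close>

definition diamond ::
  "'m itself \<Rightarrow> 'e itself \<Rightarrow> ('a, 'c) ring_scheme \<Rightarrow> bool" where
  "diamond _ _ A \<longleftrightarrow> ring A \<and> noetherian_ring A \<and>
     (\<forall>(M :: ('a, 'm) module) (E :: ('a, 'e) module) \<iota>.
        simple_module A M \<and> injective_hull A M E \<iota> \<longrightarrow> locally_artinian A E) \<and>
     (\<forall>(M :: ('a, 'm) module) (E :: ('a, 'e) module) \<iota>.
        simple_module (opposite_ring A) M \<and> injective_hull (opposite_ring A) M E \<iota> \<longrightarrow>
        locally_artinian (opposite_ring A) E)"


section \<open>Skew polynomial rings\<close>

text \<open>
  A polynomial stands for the sum of its \<open>a\<^sub>i \<theta>\<^sup>i\<close>, with coefficients
  on the left. The rule \<open>\<theta> r = \<alpha>(r) \<theta>\<close> gives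
  \<open>a \<theta>\<^sup>i b \<theta>\<^sup>j = a \<alpha>\<^sup>i(b) \<theta>\<^sup>i\<^sup>+\<^sup>j\<close>.
\<close>

definition skew_times :: "('r \<Rightarrow> 'r) \<Rightarrow> 'r::comm_ring_1 poly \<Rightarrow> 'r poly \<Rightarrow> 'r poly" where
  "skew_times \<alpha> p q =
     (\<Sum>i\<le>degree p. \<Sum>j\<le>degree q. monom (coeff p i * (\<alpha> ^^ i) (coeff q j)) (i + j))"

lemma coeff_skew_times:
  assumes "\<alpha> 0 = 0"
  shows "coeff (skew_times \<alpha> p q) n = (\<Sum>i\<le>n. coeff p i * (\<alpha> ^^ i) (coeff q (n - i)))"
proof -
  have z: "(\<alpha> ^^ i) 0 = 0" for i by (induction i) (auto simp: assms)
  have "coeff (skew_times \<alpha> p q) n = (\<Sum>i\<le>degree p. \<Sum>j\<le>degree q.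
      if i + j = n then coeff p i * (\<alpha> ^^ i) (coeff q j) else 0)"
    by (simp add: skew_times_def coeff_sum)
  also have "\<dots> = (\<Sum>i\<le>degree p. if i \<le> n then coeff p i * (\<alpha> ^^ i) (coeff q (n - i)) else 0)"
  proof (rule sum.cong[OF refl])
    fix i
    have "(\<Sum>j\<le>degree q. if i + j = n then coeff p i * (\<alpha> ^^ i) (coeff q j) else 0) =
      (\<Sum>j\<in>{j. j \<le> degree q \<and> i + j = n}. coeff p i * (\<alpha> ^^ i) (coeff q j))"
      by (rule sum.mono_neutral_cong_right) auto
    also have "{j. j \<le> degree q \<and> i + j = n} = (if i \<le> n \<and> n - i \<le> degree q then {n - i} else {})"
      by auto
    finally show "(\<Sum>j\<le>degree q. if i + j = n then coeff p i * (\<alpha> ^^ i) (coeff q j) else 0) =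
      (if i \<le> n then coeff p i * (\<alpha> ^^ i) (coeff q (n - i)) else 0)"
      by (auto simp: z coeff_eq_0)
  qed
  also have "\<dots> = (\<Sum>i\<in>{i. i \<le> n \<and> i \<le> degree p}. coeff p i * (\<alpha> ^^ i) (coeff q (n - i)))"
    by (rule sum.mono_neutral_cong_right) auto
  also have "\<dots> = (\<Sum>i\<le>n. coeff p i * (\<alpha> ^^ i) (coeff q (n - i)))"
    by (rule sum.mono_neutral_left) (auto intro: le_degree)
  finally show ?thesis .
qed

lemma theta_times_const:
  assumes "\<alpha> 0 = 0" "\<alpha> 1 = 1"
  shows "skew_times \<alpha> (monom 1 1) [:r:] = skew_times \<alpha> [:\<alpha> r:] (monom 1 1)"
  by (cases "\<alpha> r = 0"; cases "r = 0") (auto simp: skew_times_def degree_monom_eq coeff_pCons assms numeral_eq_Suc)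

definition skew_poly_ring :: "('r \<Rightarrow> 'r) \<Rightarrow> 'r::comm_ring_1 poly ring" where
  "skew_poly_ring \<alpha> =
     \<lparr>carrier = UNIV, monoid.mult = skew_times \<alpha>, one = 1, zero = 0, add = (+)\<rparr>"

lemma ring_skew_poly_ring:
  fixes \<alpha> :: "'r::comm_ring_1 \<Rightarrow> 'r"
  assumes add: "\<And>x y. \<alpha> (x + y) = \<alpha> x + \<alpha> y" and mult: "\<And>x y. \<alpha> (x * y) = \<alpha> x * \<alpha> y"
    and one: "\<alpha> 1 = 1"
  shows "ring (skew_poly_ring \<alpha>)"
proof -
  have z: "\<alpha> 0 = 0" using add[of 0 0] by simp
  have padd: "(\<alpha> ^^ i) (x + y) = (\<alpha> ^^ i) x + (\<alpha> ^^ i) y" for i x y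
    by (induction i) (auto simp: add)
  have pmult: "(\<alpha> ^^ i) (x * y) = (\<alpha> ^^ i) x * (\<alpha> ^^ i) y" for i x y
    by (induction i) (auto simp: mult)
  have pone: "(\<alpha> ^^ i) 1 = 1" for i by (induction i) (auto simp: one)
  have pz: "(\<alpha> ^^ i) 0 = 0" for i by (induction i) (auto simp: z)
  have psum: "(\<alpha> ^^ i) (sum f S) = (\<Sum>s\<in>S. (\<alpha> ^^ i) (f s))" for i f and S :: "nat set"
    by (induction S rule: infinite_finite_induct) (auto simp: padd pz)
  note c = coeff_skew_times[of \<alpha>, OF z]
  have assoc: "skew_times \<alpha> (skew_times \<alpha> p q) r = skew_times \<alpha> p (skew_times \<alpha> q r)" for p q r
  proof (rule poly_eqI)
    fix n
    define F where "F i j k = coeff p i * (\<alpha> ^^ i) (coeff q j) * (\<alpha> ^^ (i + j)) (coeff r k)" for i j k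
    have "coeff (skew_times \<alpha> (skew_times \<alpha> p q) r) n = (\<Sum>m\<le>n. \<Sum>i\<le>m. F i (m - i) (n - m))"
      by (simp add: c F_def sum_distrib_right)
    also have "\<dots> = (\<Sum>i\<le>n. \<Sum>j\<le>n - i. F i j (n - i - j))"
      unfolding sum.Sigma[OF finite_atMost ballI[OF finite_atMost]]
      by (rule sum.reindex_bij_witness[of _ "\<lambda>(i, j). (i + j, i)" "\<lambda>(m, i). (i, m - i)"]) auto
    also have "\<dots> = coeff (skew_times \<alpha> p (skew_times \<alpha> q r)) n"
      by (simp add: c F_def psum pmult sum_distrib_left funpow_add mult.assoc)
    finally show "coeff (skew_times \<alpha> (skew_times \<alpha> p q) r) n = coeff (skew_times \<alpha> p (skew_times \<alpha> q r)) n" .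
  qed
  have onel: "skew_times \<alpha> 1 p = p" for p
    by (simp add: skew_times_def poly_as_sum_of_monoms)
  have oner: "skew_times \<alpha> p 1 = p" for p
    by (simp add: skew_times_def pone poly_as_sum_of_monoms)
  have "abelian_group (skew_poly_ring \<alpha>)"
    by (rule abelian_groupI) (auto simp: skew_poly_ring_def add_ac intro: exI[of _ "- _"])
  moreover have "monoid (skew_poly_ring \<alpha>)"
    by (rule monoidI) (auto simp: skew_poly_ring_def assoc onel oner)
  ultimately show ?thesis
    by (rule ringI)
      (auto simp: skew_poly_ring_def poly_eq_iff c padd distrib_left distrib_right sum.distrib)
qed

definition fps_algebra_automorphism :: "('k::field fps \<Rightarrow> 'k fps) \<Rightarrow> bool" where
  "fps_algebra_automorphism \<alpha> \<longleftrightarrow> bij \<alpha> \<and>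
     (\<forall>f g. \<alpha> (f + g) = \<alpha> f + \<alpha> g) \<and>
     (\<forall>f g. \<alpha> (f * g) = \<alpha> f * \<alpha> g) \<and>
     (\<forall>c. \<alpha> (fps_const c) = fps_const c)"

end

theory Submission
  imports Defs "HOL-Algebra.AbelCoset"
begin

text \<open>
  Write \<open>A\<close> for the power series ring and \<open>S\<close> for the skew polynomial ring. An automorphism of
  the discrete valuation ring \<open>A\<close> preserves the valuation and, being \<open>k\<close>-linear, also constant
  terms. Hence \<open>X\<close> is a normal element of \<open>S\<close> (\<open>X S = S X\<close>), and \<open>S / X S\<close> is the commutative
  polynomial ring in \<open>\<theta>\<close> over \<open>k\<close>.

  Let \<open>E\<close> be an essential extension of a simple module and \<open>v\<close> a nonzero element of that simple
  module. Then \<open>v\<close> lies in \<open>S x\<close> for every nonzero \<open>x\<close> of \<open>E\<close>; the whole argument about \<open>E\<close> runs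
  on this property of \<open>v\<close>. Since finite sums of Artinian submodules are Artinian, it is enough to
  treat cyclic submodules \<open>S x\<close>. The submodules of \<open>S x\<close> correspond to the left ideals of \<open>S\<close> that
  contain the annihilator of \<open>x\<close>, and chains of left ideals are controlled by the degrees of their
  elements together with the valuations of the leading coefficients. This gives the Noetherian
  property too (\<open>left_ideal_acc\<close>), and two descending chain conditions (\<open>left_ideal_dcc\<close>,
  \<open>left_ideal_saturated_dcc\<close>), one for each of two cases.

  If \<open>X v = 0\<close>, then each \<open>x\<close> is killed by a power of \<open>X\<close>: a normal element that kills \<open>v\<close> acts
  nilpotently on each cyclic module (\<open>normal_action_nilpotent\<close>). Likewise some polynomial with a
  unit leading coefficient kills \<open>v\<close>, and it acts as a central element on the elements killed by \<open>X\<close>.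
  Together, every \<open>x\<close> is killed by a power of \<open>X\<close> and by a polynomial with a unit leading
  coefficient, and only finitely many pairs of a degree and a valuation are left for a left ideal
  above the annihilator.

  If \<open>X v \<noteq> 0\<close>, then \<open>X\<close> is injective on \<open>E\<close>, and simplicity gives \<open>v = X s v\<close> for some \<open>s\<close>, that
  is, \<open>v\<close> is killed by an element of \<open>1 + X S\<close>. This passes to every \<open>x\<close> in \<open>E\<close>, and this is
  the step where the completeness of \<open>A\<close> enters. Write \<open>v = f x\<close>, where after cancelling \<open>X\<close> the
  polynomial \<open>f\<close> is nonzero modulo \<open>X\<close>. Then \<open>(1 - X s') f\<close> kills \<open>x\<close>, and Hensel's method factors
  it as \<open>w u\<close> with a unit leading coefficient in \<open>w\<close> and with \<open>u\<close> in \<open>1 + X S\<close>. So \<open>w\<close> kills \<open>u x\<close>.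
  But no nonzero \<open>y\<close> is killed by a polynomial \<open>w\<close> with a unit leading coefficient
  (\<open>no_unit_lead_annihilator\<close>): for such a \<open>w\<close> of least degree the same factorization,
  used for \<open>y\<close>, shows that an element of \<open>1 + X S\<close> kills \<open>y\<close>, and then a Nakayama argument lowers
  the degree of \<open>w\<close>. Hence \<open>u x = 0\<close>. Consequently all submodules of \<open>E\<close> are closed under division
  by \<open>X\<close>, and for left ideals with this property the degrees alone decide.

  Right modules reduce to left modules, because the opposite ring of \<open>S\<close> is the skew polynomial ring
  of the inverse automorphism.
\<close>

unbundle fps_syntax

section \<open>Automorphisms of the power series ring\<close>

locale fps_automorphism =
  fixes \<alpha> :: "'k::field fps \<Rightarrow> 'k fps"
  assumes automorphism: "fps_algebra_automorphism \<alpha>"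
begin

lemma bij_alpha: "bij \<alpha>"
  and alpha_add: "\<alpha> (f + g) = \<alpha> f + \<alpha> g"
  and alpha_mult: "\<alpha> (f * g) = \<alpha> f * \<alpha> g"
  and alpha_const: "\<alpha> (fps_const c) = fps_const c"
  using automorphism by (auto simp: fps_algebra_automorphism_def)

lemma alpha_0 [simp]: "\<alpha> 0 = 0" and alpha_1 [simp]: "\<alpha> 1 = 1"
  using alpha_const[of 0] alpha_const[of 1] by simp_all

lemma alpha_eq_0_iff: "\<alpha> f = 0 \<longleftrightarrow> f = 0"
  using inj_eq[OF bij_is_inj[OF bij_alpha], of f 0] by simp

lemma alpha_minus: "\<alpha> (f - g) = \<alpha> f - \<alpha> g"
  using alpha_add[of "f - g" g] by (simp add: eq_diff_eq)

lemma fps_automorphism_inv: "fps_automorphism (inv_into UNIV \<alpha>)"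
proof -
  have surj: "\<alpha> (inv_into UNIV \<alpha> f) = f" for f
    using bij_alpha by (simp add: bij_is_surj surj_f_inv_f)
  have inv: "inv_into UNIV \<alpha> g = f" if "\<alpha> f = g" for f g
    using inv_f_f[OF bij_is_inj[OF bij_alpha], of f] that by simp
  have "inv_into UNIV \<alpha> (f + g) = inv_into UNIV \<alpha> f + inv_into UNIV \<alpha> g"
    "inv_into UNIV \<alpha> (f * g) = inv_into UNIV \<alpha> f * inv_into UNIV \<alpha> g"
    "inv_into UNIV \<alpha> (fps_const c) = fps_const c" for f g c
    by (rule inv; simp add: alpha_add alpha_mult alpha_const surj)+
  then show ?thesis
    unfolding fps_automorphism_def fps_algebra_automorphism_def
    using bij_imp_bij_inv[OF bij_alpha] by blast
qed

text \<open>
  The constant term of \<open>f\<close> is the only constant \<open>c\<close> for which \<open>f - c\<close> is not a unit, and an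
  automorphism that fixes the constants preserves this characterization.
\<close>

lemma alpha_nth_0: "\<alpha> f $ 0 = f $ 0"
proof -
  have unit: "g dvd 1" if "\<alpha> g dvd 1" for g
  proof -
    obtain h where h: "1 = \<alpha> g * h" using \<open>\<alpha> g dvd 1\<close> by (elim dvdE)
    obtain h' where "h = \<alpha> h'" using surjD[OF bij_is_surj[OF bij_alpha]] by blast
    then have "\<alpha> (g * h') = \<alpha> 1" using h by (simp add: alpha_mult)
    then have "g * h' = 1" using inj_eq[OF bij_is_inj[OF bij_alpha], of "g * h'" 1] by simp
    then show ?thesis by (rule dvdI[OF sym])
  qed
  have unit': "\<alpha> g dvd 1" if "g dvd 1" for g
  proof -
    obtain h where "1 = g * h" using \<open>g dvd 1\<close> by (elim dvdE)
    then have "1 = \<alpha> g * \<alpha> h" by (simp flip: alpha_mult)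
    then show ?thesis by (rule dvdI)
  qed
  have "f - fps_const (\<alpha> f $ 0) dvd 1 \<longleftrightarrow> \<alpha> f - fps_const (\<alpha> f $ 0) dvd 1"
    using unit unit' by (metis alpha_minus alpha_const)
  then show ?thesis by simp
qed

text \<open>
  Both \<open>\<alpha>\<close> and its inverse map \<open>X\<close> into the maximal ideal. If \<open>\<alpha> X\<close> had valuation at least 2,
  then applying \<open>\<alpha>\<close> to the preimage of \<open>X\<close> would give a valuation of at least 2 for \<open>X\<close> itself.
\<close>

lemma subdegree_alpha_X: "subdegree (\<alpha> fps_X) = 1"
proof -
  interpret inv: fps_automorphism "inv_into UNIV \<alpha>" by (rule fps_automorphism_inv)
  have nz: "\<alpha> fps_X \<noteq> 0" by (simp add: alpha_eq_0_iff)
  have pos: "subdegree (\<alpha> fps_X) \<noteq> 0"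
    using nz alpha_nth_0[of fps_X] by (simp add: subdegree_eq_0_iff)
  have "inv_into UNIV \<alpha> fps_X \<noteq> 0" "inv_into UNIV \<alpha> fps_X $ 0 = 0"
    using inv.alpha_nth_0[of fps_X] by (simp_all add: inv.alpha_eq_0_iff)
  then have "fps_X dvd inv_into UNIV \<alpha> fps_X"
    by (simp add: fps_dvd_iff Suc_le_eq) (metis gr0I subdegree_eq_0_iff)
  then obtain g where g: "inv_into UNIV \<alpha> fps_X = fps_X * g" by blast
  have "\<alpha> fps_X * \<alpha> g = fps_X"
    using bij_alpha by (metis alpha_mult g bij_is_surj surj_f_inv_f)
  moreover from this have "\<alpha> g \<noteq> 0" by auto
  ultimately have "subdegree (\<alpha> fps_X) + subdegree (\<alpha> g) = 1"
    using nz subdegree_mult[of "\<alpha> fps_X" "\<alpha> g"] by simp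
  then show ?thesis using pos by linarith
qed

lemma subdegree_alpha: "subdegree (\<alpha> f) = subdegree f"
proof (cases "f = 0")
  case False
  define u where "u = unit_factor f"
  have f: "f = fps_X ^ subdegree f * u"
    unfolding u_def by (rule fps_unit_factor_decompose')
  have u: "u $ 0 \<noteq> 0"
    using False by (simp add: u_def)
  have pow: "\<alpha> (fps_X ^ n) = \<alpha> fps_X ^ n" for n
    by (induction n) (simp_all add: alpha_mult)
  have "\<alpha> f = \<alpha> fps_X ^ subdegree f * \<alpha> u"
    by (subst f) (simp add: alpha_mult pow)
  moreover have "\<alpha> u $ 0 \<noteq> 0" using u by (simp add: alpha_nth_0)
  moreover have "\<alpha> fps_X \<noteq> 0" by (simp add: alpha_eq_0_iff)
  moreover have "\<alpha> u \<noteq> 0" "subdegree (\<alpha> u) = 0" using \<open>\<alpha> u $ 0 \<noteq> 0\<close> by auto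
  ultimately show ?thesis by (simp add: subdegree_alpha_X)
qed simp

lemma pow_alpha_0 [simp]: "(\<alpha> ^^ i) 0 = 0"
  by (induction i) simp_all

lemma pow_alpha_nth_0: "(\<alpha> ^^ i) f $ 0 = f $ 0"
  by (induction i) (simp_all add: alpha_nth_0)

lemma subdegree_pow_alpha: "subdegree ((\<alpha> ^^ i) f) = subdegree f"
  by (induction i) (simp_all add: subdegree_alpha)

lemma pow_alpha_eq_0_iff: "(\<alpha> ^^ i) f = 0 \<longleftrightarrow> f = 0"
  by (induction i) (simp_all add: alpha_eq_0_iff)

lemma surj_pow_alpha: "\<exists>f. (\<alpha> ^^ i) f = g"
  using bij_is_surj[OF bij_fn[OF bij_alpha, of i]] by (simp add: surj_def) metis

lemma X_power_dvd_iff: "fps_X ^ n dvd (f :: 'k fps) \<longleftrightarrow> f = 0 \<or> n \<le> subdegree f"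
  by (cases "f = 0") (simp_all add: fps_dvd_iff)

lemma X_power_dvd_pow_alpha: "fps_X ^ n dvd (\<alpha> ^^ i) f \<longleftrightarrow> fps_X ^ n dvd f"
  by (simp add: X_power_dvd_iff subdegree_pow_alpha pow_alpha_eq_0_iff)

lemma pow_alpha_X_power:
  obtains g where "g $ 0 \<noteq> 0" "(\<alpha> ^^ i) (fps_X ^ n) = fps_X ^ n * g"
proof -
  let ?f = "(\<alpha> ^^ i) (fps_X ^ n)"
  have nz: "?f \<noteq> 0" by (simp add: pow_alpha_eq_0_iff)
  have "subdegree ?f = n" by (simp add: subdegree_pow_alpha)
  then have "?f = fps_X ^ n * unit_factor ?f" by (metis fps_unit_factor_decompose')
  then show ?thesis using that nz fps_unit_factor_nth_0 by blast
qed

section \<open>Arithmetic of skew polynomials\<close>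

abbreviation skew_mult (infixl "\<star>" 70) where "p \<star> q \<equiv> skew_times \<alpha> p q"

lemma ring_skew: "ring (skew_poly_ring \<alpha>)"
  by (rule ring_skew_poly_ring) (simp_all add: alpha_add alpha_mult)

lemma skew_poly_ring_simps [simp]:
  "carrier (skew_poly_ring \<alpha>) = UNIV" "x \<otimes>\<^bsub>skew_poly_ring \<alpha>\<^esub> y = x \<star> y"
  "x \<oplus>\<^bsub>skew_poly_ring \<alpha>\<^esub> y = x + y" "\<one>\<^bsub>skew_poly_ring \<alpha>\<^esub> = 1" "\<zero>\<^bsub>skew_poly_ring \<alpha>\<^esub> = 0"
  by (simp_all add: skew_poly_ring_def)

lemma coeff_skew: "coeff (p \<star> q) n = (\<Sum>i\<le>n. coeff p i * (\<alpha> ^^ i) (coeff q (n - i)))"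
  by (rule coeff_skew_times) simp

lemma skew_assoc: "(p \<star> q) \<star> r = p \<star> (q \<star> r)"
  and skew_1_left [simp]: "1 \<star> p = p"
  and skew_1_right [simp]: "p \<star> 1 = p"
  and skew_add_left: "(p + q) \<star> r = p \<star> r + q \<star> r"
  and skew_add_right: "p \<star> (q + r) = p \<star> q + p \<star> r"
  and skew_0_left [simp]: "0 \<star> p = 0"
  and skew_0_right [simp]: "p \<star> 0 = 0"
proof -
  interpret ring "skew_poly_ring \<alpha>" by (rule ring_skew)
  show "(p \<star> q) \<star> r = p \<star> (q \<star> r)" "1 \<star> p = p" "p \<star> 1 = p"
    "(p + q) \<star> r = p \<star> r + q \<star> r" "p \<star> (q + r) = p \<star> q + p \<star> r" "0 \<star> p = 0" "p \<star> 0 = 0"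
    using m_assoc[of p q r] l_one[of p] r_one[of p] l_distr[of p q r] r_distr[of q r p]
      l_null[of p] r_null[of p] by simp_all
qed

lemma skew_diff_left: "(p - q) \<star> r = p \<star> r - q \<star> r"
  using skew_add_left[of "p - q" q r] by (simp add: algebra_simps)

lemma skew_diff_right: "p \<star> (q - r) = p \<star> q - p \<star> r"
  using skew_add_right[of p "q - r" r] by (simp add: algebra_simps)

lemma coeff_monom_skew:
  "coeff (monom c n \<star> q) m = (if n \<le> m then c * (\<alpha> ^^ n) (coeff q (m - n)) else 0)"
  by (simp add: coeff_skew if_distrib[of "\<lambda>x. x * _"] cong: if_cong)

lemma coeff_skew_monom:
  "coeff (p \<star> monom c n) m = (if n \<le> m then coeff p (m - n) * (\<alpha> ^^ (m - n)) c else 0)"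
proof -
  have "coeff (p \<star> monom c n) m =
    (\<Sum>i\<le>m. if i = m - n \<and> n \<le> m then coeff p i * (\<alpha> ^^ i) c else 0)"
    unfolding coeff_skew by (rule sum.cong) auto
  then show ?thesis by (cases "n \<le> m") simp_all
qed

lemma const_skew: "[:c:] \<star> q = smult c q"
  by (rule poly_eqI) (simp add: coeff_monom_skew flip: monom_0)

lemma coeff_skew_const: "coeff (p \<star> [:c:]) m = coeff p m * (\<alpha> ^^ m) c"
  using coeff_skew_monom[of p c 0 m] by (simp add: monom_0)

lemma skew_smult_left: "smult c p \<star> q = smult c (p \<star> q)"
  by (simp flip: const_skew add: skew_assoc)

lemma X_power_dvd_skew_left: "[:fps_X ^ n:] dvd p \<Longrightarrow> [:fps_X ^ n:] dvd p \<star> q"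
  and X_power_dvd_skew_right: "[:fps_X ^ n:] dvd q \<Longrightarrow> [:fps_X ^ n:] dvd p \<star> q"
  unfolding const_poly_dvd_iff coeff_skew
  by (auto intro!: dvd_sum intro: dvd_mult dvd_mult2 simp: X_power_dvd_pow_alpha)

lemma X_power_dvdE:
  assumes "[:fps_X ^ n:] dvd p"
  obtains q where "p = smult (fps_X ^ n) q"
  using assms by (elim dvdE) (simp add: that)

lemma poly_of_coeffs:
  fixes f :: "nat \<Rightarrow> 'a::comm_monoid_add"
  assumes "\<And>i. i > D \<Longrightarrow> f i = 0"
  obtains p where "\<And>i. coeff p i = f i"
  using that[of "\<Sum>i\<le>D. monom (f i) i"] assms by (force simp: coeff_sum)

text \<open>
  One half of the normality of \<open>X\<close>: moving \<open>X\<^sup>n\<close> from the right to the left of \<open>p\<close> multiplies each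
  coefficient by a unit, since \<open>\<alpha>\<close> maps \<open>X\<close> to a unit multiple of \<open>X\<close>. The form of the new
  coefficients shows that degrees and units among the coefficients are kept.
\<close>

lemma skew_X_power:
  obtains q g where "p \<star> [:fps_X ^ n:] = smult (fps_X ^ n) q"
    "\<And>i. coeff q i = coeff p i * g i" "\<And>i. g i $ 0 \<noteq> 0"
proof -
  have "\<forall>i. \<exists>g. g $ 0 \<noteq> 0 \<and> (\<alpha> ^^ i) (fps_X ^ n) = fps_X ^ n * g"
    using pow_alpha_X_power by metis
  then obtain g where g: "\<And>i. g i $ 0 \<noteq> 0" "\<And>i. (\<alpha> ^^ i) (fps_X ^ n) = fps_X ^ n * g i"
    by metis
  obtain q where q: "\<And>i. coeff q i = coeff p i * g i"
    by (rule poly_of_coeffs[of "degree p" "\<lambda>i. coeff p i * g i"]) (auto simp: coeff_eq_0)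
  have "p \<star> [:fps_X ^ n:] = smult (fps_X ^ n) q"
    by (rule poly_eqI) (simp add: coeff_skew_const q g)
  then show ?thesis using that q g by blast
qed

lemma X_power_skew:
  obtains q where "smult (fps_X ^ n) p = q \<star> [:fps_X ^ n:]"
proof -
  have "\<forall>i. \<exists>g. g $ 0 \<noteq> 0 \<and> (\<alpha> ^^ i) (fps_X ^ n) = fps_X ^ n * g"
    using pow_alpha_X_power by metis
  then obtain g where g: "\<And>i. g i $ 0 \<noteq> 0" "\<And>i. (\<alpha> ^^ i) (fps_X ^ n) = fps_X ^ n * g i"
    by metis
  obtain q where q: "\<And>i. coeff q i = coeff p i * inverse (g i)"
    by (rule poly_of_coeffs[of "degree p" "\<lambda>i. coeff p i * inverse (g i)"])
      (auto simp: coeff_eq_0)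
  have "inverse (g i) * g i = 1" for i using g by (simp add: inverse_mult_eq_1)
  then have "smult (fps_X ^ n) p = q \<star> [:fps_X ^ n:]"
    by (intro poly_eqI) (simp add: coeff_skew_const q g mult_ac)
  then show ?thesis using that by blast
qed

text \<open>
  As for ordinary polynomials over a domain: no cancellation at the top, because \<open>\<alpha>\<close> is injective.
\<close>

lemma degree_lead_coeff_skew:
  assumes "p \<noteq> 0" "q \<noteq> 0"
  shows "degree (p \<star> q) = degree p + degree q"
    and "lead_coeff (p \<star> q) = lead_coeff p * (\<alpha> ^^ degree p) (lead_coeff q)"
    and "p \<star> q \<noteq> 0"
proof -
  let ?n = "degree p + degree q"
  have "coeff (p \<star> q) ?n =
      (\<Sum>i\<le>?n. if i = degree p then lead_coeff p * (\<alpha> ^^ degree p) (lead_coeff q) else 0)"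
    unfolding coeff_skew
  proof (rule sum.cong)
    fix i show "coeff p i * (\<alpha> ^^ i) (coeff q (?n - i)) =
        (if i = degree p then lead_coeff p * (\<alpha> ^^ degree p) (lead_coeff q) else 0)"
      by (cases i "degree p" rule: linorder_cases) (auto simp: coeff_eq_0)
  qed simp
  then have top: "coeff (p \<star> q) ?n = lead_coeff p * (\<alpha> ^^ degree p) (lead_coeff q)" by simp
  then have nz: "coeff (p \<star> q) ?n \<noteq> 0" using assms by (simp add: pow_alpha_eq_0_iff)
  have "coeff (p \<star> q) m = 0" if "m > ?n" for m
    unfolding coeff_skew
  proof (rule sum.neutral, rule ballI)
    fix i show "coeff p i * (\<alpha> ^^ i) (coeff q (m - i)) = 0"
      using that by (cases "i \<le> degree p") (auto simp: coeff_eq_0)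
  qed
  then have deg: "degree (p \<star> q) = ?n"
    using nz by (metis le_antisym le_degree degree_le)
  with top nz show "degree (p \<star> q) = ?n" "p \<star> q \<noteq> 0"
    "lead_coeff (p \<star> q) = lead_coeff p * (\<alpha> ^^ degree p) (lead_coeff q)" by auto
qed

text \<open>
  Division with remainder is possible on either side by a polynomial whose leading coefficient is a
  unit. The remainder is described by its vanishing coefficients, so that the case of a zero remainder
  needs no distinction.
\<close>

lemma skew_division:
  assumes w: "lead_coeff w $ 0 \<noteq> 0"
  shows "\<exists>q. \<forall>i\<ge>degree w. coeff (s - q \<star> w) i = 0"
proof -
  let ?d = "degree w"
  have "\<exists>q. \<forall>i\<ge>?d. coeff (s - q \<star> w) i = 0" if "\<forall>i\<ge>?d + n. coeff s i = 0" for n s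
    using that
  proof (induction n arbitrary: s)
    case 0
    then show ?case by (intro exI[of _ 0]) simp
  next
    case (Suc n)
    let ?u = "(\<alpha> ^^ n) (lead_coeff w)"
    define c where "c = coeff s (?d + n) * inverse ?u"
    have cu: "c * ?u = coeff s (?d + n)"
      using w by (simp add: c_def mult.assoc inverse_mult_eq_1 pow_alpha_nth_0)
    have "coeff (s - monom c n \<star> w) i = 0" if "i \<ge> ?d + n" for i
    proof (cases "i = ?d + n")
      case True
      then show ?thesis using cu by (simp add: coeff_monom_skew)
    next
      case False
      with that Suc.prems have "coeff s i = 0" "i - n > ?d" by auto
      then show ?thesis by (simp add: coeff_monom_skew coeff_eq_0)
    qed
    then obtain q where "\<forall>i\<ge>?d. coeff (s - monom c n \<star> w - q \<star> w) i = 0"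
      using Suc.IH by blast
    then show ?case
      by (intro exI[of _ "monom c n + q"]) (simp add: skew_add_left diff_diff_eq)
  qed
  from this[of "Suc (degree s)"] show ?thesis by (auto simp: coeff_eq_0)
qed

text \<open>
  With the divisor on the left, the top coefficient of the quotient is found by solving an equation
  for its image under a power of \<open>\<alpha>\<close>; this is where surjectivity enters. The degree bound on the
  quotient is what keeps the factors in Hensel's method polynomials.
\<close>

lemma skew_division_right:
  assumes w: "lead_coeff w $ 0 \<noteq> 0" and s: "\<forall>i\<ge>degree w + n. coeff s i = 0"
  shows "\<exists>q. (\<forall>i\<ge>n. coeff q i = 0) \<and> (\<forall>i\<ge>degree w. coeff (s - w \<star> q) i = 0)"
  using s
proof (induction n arbitrary: s)
  case 0
  then show ?case by (intro exI[of _ 0]) simp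
next
  case (Suc n)
  let ?d = "degree w"
  obtain c where c: "(\<alpha> ^^ ?d) c = inverse (lead_coeff w) * coeff s (?d + n)"
    using surj_pow_alpha by blast
  have cu: "lead_coeff w * (\<alpha> ^^ ?d) c = coeff s (?d + n)"
    using w by (simp add: c inverse_mult_eq_1' flip: mult.assoc)
  have "coeff (s - w \<star> monom c n) i = 0" if "i \<ge> ?d + n" for i
  proof (cases "i = ?d + n")
    case True
    then show ?thesis using cu by (simp add: coeff_skew_monom)
  next
    case False
    with that Suc.prems have "coeff s i = 0" "i - n > ?d" by auto
    then show ?thesis by (simp add: coeff_skew_monom coeff_eq_0)
  qed
  then obtain q where q: "\<forall>i\<ge>n. coeff q i = 0"
    "\<forall>i\<ge>?d. coeff (s - w \<star> monom c n - w \<star> q) i = 0"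
    using Suc.IH by blast
  then show ?case
    by (intro exI[of _ "monom c n + q"]) (auto simp: skew_add_right diff_diff_eq)
qed

section \<open>Hensel factorization\<close>

lemma X_power_dvd_nth: "fps_X ^ n dvd (f :: 'k fps) \<longleftrightarrow> (\<forall>j<n. f $ j = 0)"
proof
  assume "fps_X ^ n dvd f"
  then show "\<forall>j<n. f $ j = 0" by (auto simp: fps_X_power_mult_nth elim!: dvdE)
next
  assume "\<forall>j<n. f $ j = 0"
  then have "f = fps_X ^ n * fps_shift n f"
    by (intro fps_ext) (simp add: fps_X_power_mult_nth)
  then show "fps_X ^ n dvd f" by (rule dvdI)
qed

lemma X_dvd_nth: "fps_X dvd (f :: 'k fps) \<longleftrightarrow> f $ 0 = 0"
  using X_power_dvd_nth[of 1 f] by simp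

text \<open>
  Completeness of the power series ring, for polynomials of bounded degree: the \<open>j\<close>-th power series
  coefficient of the limit is read off from the \<open>j\<close>-th member of the sequence, from where on it no
  longer changes.
\<close>

lemma poly_limit:
  fixes p :: "nat \<Rightarrow> 'k fps poly"
  assumes bound: "\<And>n i. i > D \<Longrightarrow> coeff (p n) i = 0"
    and step: "\<And>n. [:fps_X ^ Suc n:] dvd p (Suc n) - p n"
  obtains q where "\<And>i. i > D \<Longrightarrow> coeff q i = 0" "\<And>n. [:fps_X ^ Suc n:] dvd q - p n"
proof -
  have same: "coeff (p (n + m)) i $ j = coeff (p n) i $ j" if "j \<le> n" for i j n m
  proof (induction m)
    case (Suc m)
    have "fps_X ^ Suc (n + m) dvd coeff (p (Suc (n + m)) - p (n + m)) i"
      using step[of "n + m"] by (simp add: const_poly_dvd_iff del: coeff_diff)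
    then have "coeff (p (Suc (n + m)) - p (n + m)) i $ j = 0"
      using that unfolding X_power_dvd_nth by simp
    then show ?case using Suc by simp
  qed simp
  have "Abs_fps (\<lambda>j. coeff (p j) i $ j) = 0" if "i > D" for i
    using that by (intro fps_ext) (simp add: bound)
  then obtain q where q: "\<And>i. coeff q i = Abs_fps (\<lambda>j. coeff (p j) i $ j)"
    by (rule poly_of_coeffs) blast+
  show ?thesis
  proof (rule that)
    show "coeff q i = 0" if "i > D" for i using that by (simp add: q bound fps_eq_iff)
    show "[:fps_X ^ Suc n:] dvd q - p n" for n
      unfolding const_poly_dvd_iff X_power_dvd_nth
    proof (intro allI impI)
      fix i j assume "j < Suc n"
      then have "coeff (p (j + (n - j))) i $ j = coeff (p j) i $ j" by (intro same) simp
      with \<open>j < Suc n\<close> show "coeff (q - p n) i $ j = 0" by (simp add: q)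
    qed
  qed
qed

lemma poly_eq_0_if_X_power_dvd:
  fixes p :: "'k fps poly"
  assumes "\<And>n. [:fps_X ^ Suc n:] dvd p"
  shows "p = 0"
proof (rule poly_eqI, rule fps_ext)
  fix i j
  have "fps_X ^ Suc j dvd coeff p i" using assms[of j] by (simp add: const_poly_dvd_iff)
  then show "coeff p i $ j = coeff 0 i $ j" unfolding X_power_dvd_nth by simp
qed

lemma coeff_unit_if_X_dvd_diff:
  assumes "[:fps_X ^ Suc n:] dvd (p - q :: 'k fps poly)"
  shows "coeff p i $ 0 = coeff q i $ 0"
proof -
  have "fps_X ^ Suc n dvd coeff (p - q) i" using assms by (simp add: const_poly_dvd_iff del: coeff_diff)
  then show ?thesis unfolding X_power_dvd_nth by simp
qed

lemma X_power_dvd_smult: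
  "[:fps_X ^ m:] dvd q \<Longrightarrow> [:fps_X ^ (n + m):] dvd smult (fps_X ^ n) (q :: 'k fps poly)"
  unfolding const_poly_dvd_iff by (simp add: power_add mult_dvd_mono)

text \<open>
  If \<open>w u\<close> agrees with \<open>h\<close> modulo \<open>X\<^sup>m\<close>, the error is \<open>X\<^sup>m c\<close>. Replacing \<open>w\<close> by \<open>w + X\<^sup>m a\<close> and \<open>u\<close>
  by \<open>u + X\<^sup>m b\<close> changes the product by \<open>X\<^sup>m (a + w' b)\<close> modulo \<open>X\<^sup>m\<^sup>+\<^sup>1\<close>, because \<open>u\<close> is 1 modulo \<open>X\<close>;
  here \<open>w'\<close> comes from moving \<open>X\<^sup>m\<close> past \<open>w\<close>. So \<open>b\<close> and \<open>a\<close> are the quotient and the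
  remainder in the division of \<open>c\<close> by \<open>w'\<close>.
\<close>

lemma hensel_step:
  fixes h w u :: "'k fps poly"
  assumes h: "\<And>i. i > d + N \<Longrightarrow> coeff h i = 0"
    and w: "\<And>i. i > d \<Longrightarrow> coeff w i = 0" "coeff w d $ 0 \<noteq> 0"
    and u: "\<And>i. i > N \<Longrightarrow> coeff u i = 0" "[:fps_X:] dvd u - 1"
    and e: "[:fps_X ^ Suc n:] dvd h - w \<star> u"
  obtains w' u' where "\<And>i. i > d \<Longrightarrow> coeff w' i = 0" "\<And>i. i > N \<Longrightarrow> coeff u' i = 0"
    "[:fps_X ^ Suc n:] dvd w' - w" "[:fps_X ^ Suc n:] dvd u' - u"
    "[:fps_X ^ Suc (Suc n):] dvd h - w' \<star> u'"
proof -
  let ?X = "[:fps_X ^ Suc n:]"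
  have X: "?X \<star> p = smult (fps_X ^ Suc n) p" for p by (rule const_skew)
  obtain c where c: "h - w \<star> u = ?X \<star> c"
    using e unfolding X by (rule X_power_dvdE)
  obtain w1 g where w1: "w \<star> ?X = ?X \<star> w1" "\<And>i. coeff w1 i = coeff w i * g i" "\<And>i. g i $ 0 \<noteq> 0"
    unfolding X using skew_X_power[of w "Suc n"] by metis
  have w1d: "coeff w1 d $ 0 \<noteq> 0" using w1 w by simp
  have deg_w1: "degree w1 = d"
  proof (rule le_antisym)
    show "degree w1 \<le> d" by (rule degree_le) (simp add: w1 w)
    show "d \<le> degree w1" using w1d by (intro le_degree) auto
  qed
  have wu: "coeff (w \<star> u) i = 0" if "i > d + N" for i
    unfolding coeff_skew
  proof (rule sum.neutral, rule ballI)
    fix j show "coeff w j * (\<alpha> ^^ j) (coeff u (i - j)) = 0"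
      using that by (cases "j \<le> d") (auto simp: w u)
  qed
  have "coeff c i = 0" if "i > d + N" for i
  proof -
    have "coeff (?X \<star> c) i = 0" using that by (simp add: wu h del: power_Suc flip: c)
    then show ?thesis by (simp add: const_skew)
  qed
  then have "\<forall>i\<ge>degree w1 + Suc N. coeff c i = 0" by (simp add: deg_w1)
  then obtain b where b: "\<And>i. i \<ge> Suc N \<Longrightarrow> coeff b i = 0"
    "\<And>i. i \<ge> d \<Longrightarrow> coeff (c - w1 \<star> b) i = 0"
    using skew_division_right[of w1 "Suc N" c] w1d deg_w1 by auto
  \<comment> \<open>The remainder has degree below \<open>d\<close>, so the top coefficient of \<open>w\<close> never changes.\<close>
  define a where "a = c - w1 \<star> b"
  have "h - (w + ?X \<star> a) \<star> (u + ?X \<star> b) =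
      (h - w \<star> u) - (w \<star> ?X) \<star> b - ?X \<star> (a \<star> u) - ?X \<star> (a \<star> (?X \<star> b))"
    by (simp add: skew_add_left skew_add_right skew_assoc diff_diff_eq add_ac)
  also have "\<dots> = ?X \<star> (a \<star> (1 - u) - a \<star> (?X \<star> b))"
    unfolding c w1 by (simp add: skew_assoc skew_diff_right skew_add_right a_def skew_diff_left algebra_simps)
  finally have e': "h - (w + ?X \<star> a) \<star> (u + ?X \<star> b) = ?X \<star> (a \<star> (1 - u) - a \<star> (?X \<star> b))" .
  have "[:fps_X ^ 1:] dvd 1 - u" using u(2) dvd_minus_iff[of "[:fps_X:]" "u - 1"] by simp
  then have 1: "[:fps_X ^ 1:] dvd a \<star> (1 - u)" by (rule X_power_dvd_skew_right)
  have "[:fps_X ^ 1:] dvd ?X \<star> b" unfolding X const_poly_dvd_iff by (simp add: mult.assoc)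
  then have "[:fps_X ^ 1:] dvd a \<star> (?X \<star> b)" by (rule X_power_dvd_skew_right)
  with 1 have "[:fps_X ^ 1:] dvd a \<star> (1 - u) - a \<star> (?X \<star> b)" by (rule dvd_diff)
  then have "[:fps_X ^ Suc (Suc n):] dvd ?X \<star> (a \<star> (1 - u) - a \<star> (?X \<star> b))"
    unfolding X using X_power_dvd_smult[of 1 _ "Suc n"] by (simp only: Suc_eq_plus1)
  then have "[:fps_X ^ Suc (Suc n):] dvd h - (w + ?X \<star> a) \<star> (u + ?X \<star> b)" unfolding e' .
  moreover have "coeff a i = 0" if "i > d" for i using b(2)[of i] that by (simp add: a_def)
  ultimately show ?thesis
    by (intro that[of "w + ?X \<star> a" "u + ?X \<star> b"]) (simp_all add: X b w u const_poly_dvd_iff del: power_Suc)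
qed

text \<open>
  Modulo \<open>X\<close> the polynomial \<open>h\<close> has degree \<open>d\<close>. The trivial factorization of its reduction into itself
  and 1 lifts to a factorization of \<open>h\<close>, by successive approximation starting with the truncation
  of \<open>h\<close> at degree \<open>d\<close>.
\<close>

lemma hensel_factorization:
  assumes d: "coeff h d $ 0 \<noteq> 0" "\<And>i. i > d \<Longrightarrow> coeff h i $ 0 = 0"
  obtains w u where "h = w \<star> u" "degree w = d" "lead_coeff w $ 0 \<noteq> 0" "[:fps_X:] dvd u - 1"
proof -
  have "d \<le> degree h" using d(1) by (intro le_degree) auto
  \<comment> \<open>The second factor can keep this degree throughout, which makes its limit a polynomial.\<close>
  define N where "N = degree h - d"
  have h: "coeff h i = 0" if "i > d + N" for i
    using that \<open>d \<le> degree h\<close> by (simp add: N_def coeff_eq_0)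
  define P where "P n = (\<lambda>(w, u). (\<forall>i>d. coeff w i = 0) \<and> coeff w d $ 0 \<noteq> 0 \<and>
      (\<forall>i>N. coeff u i = 0) \<and> [:fps_X:] dvd u - 1 \<and> [:fps_X ^ Suc n:] dvd h - w \<star> u)" for n
  define Q where "Q n = (\<lambda>(w, u) (w', u'). [:fps_X ^ Suc n:] dvd (w' - w :: 'k fps poly) \<and>
      [:fps_X ^ Suc n:] dvd (u' - u :: 'k fps poly))" for n
  have "\<exists>f. \<forall>n. P n (f n) \<and> Q n (f n) (f (Suc n))"
  proof (rule dependent_nat_choice)
    obtain w where w: "\<And>i. coeff w i = (if i \<le> d then coeff h i else 0)"
      by (rule poly_of_coeffs[of d "\<lambda>i. if i \<le> d then coeff h i else 0"]) auto
    have "[:fps_X ^ Suc 0:] dvd h - w"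
      using d(2) by (simp add: const_poly_dvd_iff w X_dvd_nth)
    then show "\<exists>x. P 0 x"
      by (intro exI[of _ "(w, 1)"]) (simp add: P_def w d(1))
  next
    fix x n assume Px: "P n x"
    obtain w u where x: "x = (w, u)" by (cases x)
    have *: "\<And>i. i > d \<Longrightarrow> coeff w i = 0" "coeff w d $ 0 \<noteq> 0" "\<And>i. i > N \<Longrightarrow> coeff u i = 0"
      "[:fps_X:] dvd u - 1" "[:fps_X ^ Suc n:] dvd h - w \<star> u"
      using Px by (simp_all add: P_def x del: power_Suc)
    obtain w' u' where step: "\<And>i. i > d \<Longrightarrow> coeff w' i = 0" "\<And>i. i > N \<Longrightarrow> coeff u' i = 0"
      "[:fps_X ^ Suc n:] dvd w' - w" "[:fps_X ^ Suc n:] dvd u' - u"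
      "[:fps_X ^ Suc (Suc n):] dvd h - w' \<star> u'"
      using hensel_step[OF h *] by blast
    have "coeff w' d $ 0 \<noteq> 0" using coeff_unit_if_X_dvd_diff[OF step(3), of d] *(2) by simp
    moreover have "[:fps_X:] dvd u' - 1"
    proof -
      have "[:fps_X:] dvd [:fps_X ^ Suc n:]" by (rule dvdI[of _ _ "[:fps_X ^ n:]"]) (simp add: mult.commute)
      with step(4) have "[:fps_X:] dvd u' - u" by (rule dvd_trans[rotated])
      then have "[:fps_X:] dvd (u' - u) + (u - 1)" using *(4) by (rule dvd_add)
      then show ?thesis by simp
    qed
    ultimately show "\<exists>y. P (Suc n) y \<and> Q n x y"
      using step by (intro exI[of _ "(w', u')"]) (simp add: P_def Q_def x del: power_Suc)
  qed
  then obtain f where f: "\<And>n. P n (f n)" "\<And>n. Q n (f n) (f (Suc n))" by blast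
  define w u where "w n = fst (f n)" and "u n = snd (f n)" for n
  have P: "\<And>i. i > d \<Longrightarrow> coeff (w n) i = 0" "coeff (w n) d $ 0 \<noteq> 0"
    "\<And>i. i > N \<Longrightarrow> coeff (u n) i = 0" "[:fps_X:] dvd u n - 1" "[:fps_X ^ Suc n:] dvd h - w n \<star> u n"
    and Q: "[:fps_X ^ Suc n:] dvd w (Suc n) - w n" "[:fps_X ^ Suc n:] dvd u (Suc n) - u n" for n
    using f[of n] by (auto simp: P_def Q_def w_def u_def split_beta simp del: power_Suc)
  obtain w' where w': "\<And>i. i > d \<Longrightarrow> coeff w' i = 0" "\<And>n. [:fps_X ^ Suc n:] dvd w' - w n"
    using P(1) Q(1) by (rule poly_limit[of d w]) auto
  obtain u' where u': "\<And>n. [:fps_X ^ Suc n:] dvd u' - u n"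
    using P(3) Q(2) by (rule poly_limit[of N u]) auto
  have "h - w' \<star> u' = 0"
  proof (rule poly_eq_0_if_X_power_dvd)
    fix n
    have "h - w' \<star> u' = (h - w n \<star> u n) - (w' - w n) \<star> u n - w' \<star> (u' - u n)"
      by (simp add: skew_diff_left skew_diff_right)
    also have "[:fps_X ^ Suc n:] dvd \<dots>"
      by (intro dvd_diff P X_power_dvd_skew_left X_power_dvd_skew_right w' u')
    finally show "[:fps_X ^ Suc n:] dvd h - w' \<star> u'" .
  qed
  moreover have unit: "coeff w' d $ 0 \<noteq> 0"
    using coeff_unit_if_X_dvd_diff[OF w'(2)[of 0], of d] P(2)[of 0] by simp
  moreover have "degree w' = d"
  proof (rule le_antisym)
    show "degree w' \<le> d" by (rule degree_le) (simp add: w')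
    show "d \<le> degree w'" using unit by (intro le_degree) auto
  qed
  moreover have "[:fps_X:] dvd u' - 1"
  proof -
    have "[:fps_X:] dvd (u' - u 0) + (u 0 - 1)" using u'[of 0] P(4)[of 0] by (intro dvd_add) simp_all
    then show ?thesis by simp
  qed
  ultimately show ?thesis using that[of w' u'] by simp
qed

end

section \<open>Stabilizing chains of sets\<close>

lemma finite_subset_chain_union:
  fixes f :: "nat \<Rightarrow> 'a set"
  assumes "\<And>n. f n \<subseteq> f (Suc n)" "finite G" "G \<subseteq> (\<Union>n. f n)"
  shows "\<exists>n. G \<subseteq> f n"
  using assms(2,3)
proof (induction G)
  case (insert x G)
  then obtain n m where "G \<subseteq> f n" "x \<in> f m" by auto
  moreover have "f n \<subseteq> f (max n m)" "f m \<subseteq> f (max n m)"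
    by (simp_all add: lift_Suc_mono_le[of f, OF assms(1)])
  ultimately show ?case by (intro exI[of _ "max n m"]) auto
qed simp

text \<open>
  Dickson's lemma for pairs. Let \<open>(a0, b0)\<close> be a point of the union \<open>U\<close>. A point of \<open>U\<close> that is not above it
  lies in one of the finitely many columns left of \<open>a0\<close> or rows below \<open>b0\<close>, and is above the lowest
  point of that column or the leftmost point of that row. These finitely many points appear together
  at some stage of the chain.
\<close>

lemma up_closed_chain_stable:
  fixes f :: "nat \<Rightarrow> (nat \<times> nat) set"
  assumes asc: "\<And>n. f n \<subseteq> f (Suc n)"
    and up: "\<And>n a b a' b'. (a, b) \<in> f n \<Longrightarrow> a \<le> a' \<Longrightarrow> b \<le> b' \<Longrightarrow> (a', b') \<in> f n"
  shows "\<exists>m. \<forall>n\<ge>m. f n = f m"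
proof (cases "(\<Union>n. f n) = {}")
  case False
  define U where "U = (\<Union>n. f n)"
  obtain a0 b0 where ab0: "(a0, b0) \<in> U" using False unfolding U_def by fast
  define G where "G = insert (a0, b0)
    ((\<lambda>a. (a, LEAST b. (a, b) \<in> U)) ` {a. a < a0 \<and> (\<exists>b. (a, b) \<in> U)} \<union>
     (\<lambda>b. (LEAST a. (a, b) \<in> U, b)) ` {b. b < b0 \<and> (\<exists>a. (a, b) \<in> U)})"
  have "finite G" by (simp add: G_def)
  moreover have "G \<subseteq> U" using ab0 by (auto simp: G_def intro: LeastI)
  ultimately obtain m where m: "G \<subseteq> f m"
    using finite_subset_chain_union[of f, OF asc] unfolding U_def by blast
  have "U \<subseteq> f m"
  proof
    fix p assume "p \<in> U"
    then obtain a b where p: "p = (a, b)" and ab: "(a, b) \<in> U" by (cases p) auto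
    consider "a0 \<le> a" "b0 \<le> b" | "a < a0" | "b < b0" by linarith
    then show "p \<in> f m"
    proof cases
      case 1
      then show ?thesis using m up p by (auto simp: G_def)
    next
      case 2
      then have "(a, LEAST b. (a, b) \<in> U) \<in> G"
        unfolding G_def using ab by (intro insertI2 UnI1 rev_image_eqI[of a]) auto
      then have "(a, LEAST b. (a, b) \<in> U) \<in> f m" using m by blast
      moreover have "(LEAST b. (a, b) \<in> U) \<le> b" using ab by (rule Least_le)
      ultimately show ?thesis using up p by blast
    next
      case 3
      then have "(LEAST a. (a, b) \<in> U, b) \<in> G"
        unfolding G_def using ab by (intro insertI2 UnI2 rev_image_eqI[of b]) auto
      then have "(LEAST a. (a, b) \<in> U, b) \<in> f m" using m by blast
      moreover have "(LEAST a. (a, b) \<in> U) \<le> a" using ab by (rule Least_le)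
      ultimately show ?thesis using up p by blast
    qed
  qed
  moreover have "f m \<subseteq> f n" if "m \<le> n" for n using that by (rule lift_Suc_mono_le[of f, OF asc])
  ultimately show ?thesis unfolding U_def by blast
qed auto

lemma cofinite_chain_stable:
  fixes f :: "nat \<Rightarrow> 'a set"
  assumes desc: "\<And>n. f (Suc n) \<subseteq> f n" and F: "finite F" "\<And>n. - F \<subseteq> f n"
  shows "\<exists>m. \<forall>n\<ge>m. f n = f m"
proof -
  have "(\<Union>n. - f n) \<subseteq> F" using F(2) by blast
  then have "finite (\<Union>n. - f n)" using F(1) by (rule finite_subset)
  then obtain m where "(\<Union>n. - f n) \<subseteq> - f m"
    using finite_subset_chain_union[of "\<lambda>n. - f n"] desc by (metis (no_types, lifting) Compl_subset_Compl_iff subset_refl)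
  moreover have "f n \<subseteq> f m" if "m \<le> n" for n using that by (rule lift_Suc_antimono_le[of f, OF desc])
  ultimately show ?thesis by blast
qed

context fps_automorphism
begin

section \<open>Left ideals and leading exponents\<close>

definition left_ideal :: "'k fps poly set \<Rightarrow> bool" where
  "left_ideal I \<longleftrightarrow> 0 \<in> I \<and> (\<forall>f\<in>I. \<forall>g\<in>I. f + g \<in> I) \<and> (\<forall>s. \<forall>f\<in>I. s \<star> f \<in> I)"

lemma left_ideal_add: "left_ideal I \<Longrightarrow> f \<in> I \<Longrightarrow> g \<in> I \<Longrightarrow> f + g \<in> I"
  and left_ideal_skew: "left_ideal I \<Longrightarrow> f \<in> I \<Longrightarrow> s \<star> f \<in> I"
  and left_ideal_0: "left_ideal I \<Longrightarrow> 0 \<in> I"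
  by (auto simp: left_ideal_def)

lemma left_ideal_smult: "left_ideal I \<Longrightarrow> f \<in> I \<Longrightarrow> smult c f \<in> I"
  using left_ideal_skew[of I f "[:c:]"] by (simp add: const_skew)

lemma left_ideal_diff: "left_ideal I \<Longrightarrow> f \<in> I \<Longrightarrow> g \<in> I \<Longrightarrow> f - g \<in> I"
  using left_ideal_add[of I f "smult (- 1) g"] left_ideal_smult[of I g "- 1"] by simp

text \<open>
  The reduction argument of Hilbert's basis theorem: the leading term of an element \<open>q\<close> of \<open>J\<close> is
  cancelled by an element of \<open>I\<close>, which leaves an element of \<open>J\<close> of lower degree. Only a multiple \<open>c q\<close>
  need be reducible, provided that membership in \<open>I\<close> can be lifted back from \<open>c q\<close> to \<open>q\<close>.
\<close>

lemma left_ideal_subsetI: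
  assumes I: "left_ideal I" and J: "left_ideal J" and "I \<subseteq> J"
    and lead: "\<And>q. q \<in> J \<Longrightarrow> q \<noteq> 0 \<Longrightarrow> \<exists>c p. p \<in> I \<and> degree p = degree q \<and>
      lead_coeff p = c * lead_coeff q \<and> (smult c q \<in> I \<longrightarrow> q \<in> I)"
  shows "J \<subseteq> I"
proof
  fix q assume "q \<in> J"
  then show "q \<in> I"
  proof (induction "degree q" arbitrary: q rule: less_induct)
    case less
    show ?case
    proof (cases "q = 0")
      case True
      then show ?thesis using left_ideal_0[OF I] by simp
    next
      case False
      obtain c p where p: "p \<in> I" "degree p = degree q" "lead_coeff p = c * lead_coeff q"
        and sat: "smult c q \<in> I \<longrightarrow> q \<in> I"
        using lead[OF less.prems False] by blast
      let ?r = "smult c q - p"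
      have rJ: "?r \<in> J"
        using less.prems p(1) \<open>I \<subseteq> J\<close> by (intro left_ideal_diff[OF J] left_ideal_smult[OF J]) auto
      have "coeff ?r i = 0" if "i \<ge> degree q" for i
        using that p(2,3) by (cases "i = degree q") (auto simp: coeff_eq_0)
      then have "?r = 0 \<or> degree ?r < degree q"
        by (metis leading_coeff_0_iff not_le)
      then have "?r \<in> I" using less.hyps rJ left_ideal_0[OF I] by metis
      then have "?r + p \<in> I" using p(1) by (intro left_ideal_add[OF I])
      then show ?thesis using sat by simp
    qed
  qed
qed

text \<open>
  Up to units, leading terms are the \<open>X\<^sup>b \<theta>\<^sup>a\<close>. As in the theory of Groebner bases, a left ideal is
  compared with another one by the exponents of its leading terms.
\<close>

definition leading_exponents :: "'k fps poly set \<Rightarrow> (nat \<times> nat) set" where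
  "leading_exponents I = (\<lambda>f. (degree f, subdegree (lead_coeff f))) ` (I - {0})"

lemma leading_exponents_iff:
  "(a, b) \<in> leading_exponents I \<longleftrightarrow>
    (\<exists>f\<in>I. f \<noteq> 0 \<and> degree f = a \<and> subdegree (lead_coeff f) = b)"
  unfolding leading_exponents_def image_iff by blast

lemma leading_exponents_mono: "I \<subseteq> J \<Longrightarrow> leading_exponents I \<subseteq> leading_exponents J"
  unfolding leading_exponents_def by blast

lemma leading_exponents_up:
  assumes I: "left_ideal I" and ab: "(a, b) \<in> leading_exponents I" "a \<le> a'" "b \<le> b'"
  shows "(a', b') \<in> leading_exponents I"
proof -
  obtain f where f: "f \<in> I" "f \<noteq> 0" "a = degree f" "b = subdegree (lead_coeff f)"
    using ab(1) unfolding leading_exponents_iff by blast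
  let ?m = "monom (fps_X ^ (b' - b)) (a' - a) :: 'k fps poly"
  have m: "?m \<noteq> 0" "degree ?m = a' - a" "lead_coeff ?m = fps_X ^ (b' - b)"
    by (simp_all add: degree_monom_eq)
  note * = degree_lead_coeff_skew[OF m(1) f(2)]
  have "degree (?m \<star> f) = a'" using ab(2) by (simp add: * m f(3)[symmetric])
  moreover have "subdegree (lead_coeff (?m \<star> f)) = b'"
    using ab(3) f(2) unfolding *(2) m
    by (simp add: subdegree_pow_alpha pow_alpha_eq_0_iff f(4)[symmetric])
  ultimately show ?thesis
    unfolding leading_exponents_iff using *(3) left_ideal_skew[OF I f(1)] by blast
qed

lemma left_ideal_eqI:
  assumes I: "left_ideal I" and J: "left_ideal J" "I \<subseteq> J"
    and lead: "leading_exponents J \<subseteq> leading_exponents I"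
  shows "I = J"
proof
  show "J \<subseteq> I"
  proof (rule left_ideal_subsetI[OF I J])
    fix q assume q: "q \<in> J" "q \<noteq> 0"
    then have "(degree q, subdegree (lead_coeff q)) \<in> leading_exponents I"
      using lead leading_exponents_iff by blast
    then obtain f where f: "f \<in> I" "f \<noteq> 0" "degree f = degree q"
        "subdegree (lead_coeff f) = subdegree (lead_coeff q)"
      unfolding leading_exponents_iff by blast
    have nz: "lead_coeff f \<noteq> 0" "lead_coeff q \<noteq> 0" using f(2) q(2) by simp_all
    then have "lead_coeff f dvd lead_coeff q"
      unfolding fps_dvd_iff[OF nz] using f(4) by simp
    then obtain c where "lead_coeff q = lead_coeff f * c" by (elim dvdE)
    moreover from this q have "c \<noteq> 0" by auto
    ultimately show "\<exists>d p. p \<in> I \<and> degree p = degree q \<and> lead_coeff p = d * lead_coeff q \<and>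
        (smult d q \<in> I \<longrightarrow> q \<in> I)"
      using f by (intro exI[of _ 1] exI[of _ "smult c f"]) (simp add: left_ideal_smult[OF I])
  qed
qed fact

text \<open>
  If \<open>I\<close> is closed under division by \<open>X\<close>, the valuations of leading coefficients do not matter,
  because a leading coefficient divides every other one up to a power of \<open>X\<close>. The analogue over a
  field, here that of Laurent series: nested left ideals coincide if the same degrees occur in both.
\<close>

lemma left_ideal_saturated_eqI:
  assumes I: "left_ideal I" and J: "left_ideal J" "I \<subseteq> J"
    and sat: "\<And>f. smult fps_X f \<in> I \<Longrightarrow> f \<in> I"
    and deg: "degree ` (J - {0}) \<subseteq> degree ` (I - {0})"
  shows "I = J"
proof
  have sat: "smult (fps_X ^ n) f \<in> I \<Longrightarrow> f \<in> I" for n f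
    by (induction n) (auto intro: sat simp flip: smult_smult)
  show "J \<subseteq> I"
  proof (rule left_ideal_subsetI[OF I J])
    fix q assume q: "q \<in> J" "q \<noteq> 0"
    then have "degree q \<in> degree ` (I - {0})" using deg by blast
    then obtain f where "f \<in> I - {0}" "degree q = degree f" by (rule imageE)
    then have f: "f \<in> I" "f \<noteq> 0" "degree f = degree q" by auto
    let ?X = "fps_X ^ subdegree (lead_coeff f)"
    have nz: "lead_coeff f \<noteq> 0" "?X * lead_coeff q \<noteq> 0" using f(2) q(2) by simp_all
    then have "lead_coeff f dvd ?X * lead_coeff q"
      unfolding fps_dvd_iff[OF nz] by simp
    then obtain c where c: "?X * lead_coeff q = lead_coeff f * c" by (elim dvdE)
    then have "c \<noteq> 0" using nz by auto
    then have "degree (smult c f) = degree q" using f(3) by simp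
    moreover have "lead_coeff (smult c f) = ?X * lead_coeff q" unfolding c by simp
    ultimately show "\<exists>d p. p \<in> I \<and> degree p = degree q \<and> lead_coeff p = d * lead_coeff q \<and>
        (smult d q \<in> I \<longrightarrow> q \<in> I)"
      using left_ideal_smult[OF I f(1)] sat by blast
  qed
qed fact

lemma left_ideal_acc:
  assumes I: "\<And>n. left_ideal (I n)" and asc: "\<And>n. I n \<subseteq> I (Suc n)"
  shows "\<exists>m. \<forall>n\<ge>m. I n = I m"
proof -
  have "\<exists>m. \<forall>n\<ge>m. leading_exponents (I n) = leading_exponents (I m)"
    using leading_exponents_up[OF I] leading_exponents_mono[OF asc]
    by (intro up_closed_chain_stable) blast+
  then obtain m where m: "\<And>n. n \<ge> m \<Longrightarrow> leading_exponents (I n) = leading_exponents (I m)" by blast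
  have "I n = I m" if "n \<ge> m" for n
    using left_ideal_eqI[OF I I lift_Suc_mono_le[of I, OF asc that]] m[OF that] by simp
  then show ?thesis by blast
qed

text \<open>
  The exponents of \<open>X\<^sup>e\<close> and of \<open>h\<close> lie on the two axes, so that only the exponents in the rectangle
  spanned by them can distinguish the members of the chain.
\<close>

lemma left_ideal_dcc:
  assumes I: "\<And>n. left_ideal (I n)" and desc: "\<And>n. I (Suc n) \<subseteq> I n"
    and X: "\<And>n. [:fps_X ^ e:] \<in> I n" and h: "\<And>n. h \<in> I n" "lead_coeff h $ 0 \<noteq> 0"
  shows "\<exists>m. \<forall>n\<ge>m. I n = I m"
proof -
  have 0: "(0, e) \<in> leading_exponents (I n)" for n
    unfolding leading_exponents_iff using X[of n] by (intro bexI[of _ "[:fps_X ^ e:]"]) auto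
  have d: "(degree h, 0) \<in> leading_exponents (I n)" for n
    unfolding leading_exponents_iff using h by (intro bexI[of _ h]) auto
  have "- ({..<degree h} \<times> {..<e}) \<subseteq> leading_exponents (I n)" for n
  proof
    fix p assume "p \<in> - ({..<degree h} \<times> {..<e})"
    then show "p \<in> leading_exponents (I n)"
      using leading_exponents_up[OF I 0, of "fst p" "snd p" n]
        leading_exponents_up[OF I d, of "fst p" "snd p" n] by (cases p) auto
  qed
  then have "\<exists>m. \<forall>n\<ge>m. leading_exponents (I n) = leading_exponents (I m)"
    using leading_exponents_mono[OF desc]
    by (intro cofinite_chain_stable[of _ "{..<degree h} \<times> {..<e}"]) simp_all
  then obtain m where m: "\<And>n. n \<ge> m \<Longrightarrow> leading_exponents (I n) = leading_exponents (I m)" by blast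
  have "I n = I m" if "n \<ge> m" for n
    using left_ideal_eqI[OF I I lift_Suc_antimono_le[of I, OF desc that]] m[OF that] by simp
  then show ?thesis by blast
qed

text \<open>
  All degrees from that of \<open>h\<close> on occur in every member of the chain, by multiplication by powers of
  \<open>\<theta>\<close>; so only finitely many degrees can disappear along the chain.
\<close>

lemma left_ideal_saturated_dcc:
  assumes I: "\<And>n. left_ideal (I n)" and desc: "\<And>n. I (Suc n) \<subseteq> I n"
    and sat: "\<And>n f. smult fps_X f \<in> I n \<Longrightarrow> f \<in> I n" and h: "\<And>n. h \<in> I n" "h \<noteq> 0"
  shows "\<exists>m. \<forall>n\<ge>m. I n = I m"
proof -
  have "i \<in> degree ` (I n - {0})" if "i \<ge> degree h" for i n
  proof -
    let ?m = "monom 1 (i - degree h) :: 'k fps poly"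
    have "?m \<noteq> 0" by simp
    from degree_lead_coeff_skew[OF this h(2)] show ?thesis
      using that left_ideal_skew[OF I h(1)]
      by (intro image_eqI[of _ _ "?m \<star> h"]) (auto simp: degree_monom_eq)
  qed
  then have "- {..<degree h} \<subseteq> degree ` (I n - {0})" for n by auto
  then have "\<exists>m. \<forall>n\<ge>m. degree ` (I n - {0}) = degree ` (I m - {0})"
    using desc by (intro cofinite_chain_stable[of _ "{..<degree h}"] image_mono Diff_mono) simp_all
  then obtain m where m: "\<And>n. n \<ge> m \<Longrightarrow> degree ` (I n - {0}) = degree ` (I m - {0})" by blast
  have "I n = I m" if "n \<ge> m" for n
    using left_ideal_saturated_eqI[OF I I lift_Suc_antimono_le[of I, OF desc that] sat] m[OF that]
    by simp
  then show ?thesis by blast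
qed

end

section \<open>Chain conditions in modules over noncommutative rings\<close>

context left_module
begin

lemma submodule_iff:
  "submodule N R M \<longleftrightarrow> N \<subseteq> carrier M \<and> \<zero>\<^bsub>M\<^esub> \<in> N \<and> (\<forall>x\<in>N. \<forall>y\<in>N. x \<oplus>\<^bsub>M\<^esub> y \<in> N) \<and>
    (\<forall>a\<in>carrier R. \<forall>x\<in>N. a \<odot>\<^bsub>M\<^esub> x \<in> N)"
proof
  assume N: "submodule N R M"
  then interpret submodule N R M .
  show "N \<subseteq> carrier M \<and> \<zero>\<^bsub>M\<^esub> \<in> N \<and> (\<forall>x\<in>N. \<forall>y\<in>N. x \<oplus>\<^bsub>M\<^esub> y \<in> N) \<and>
      (\<forall>a\<in>carrier R. \<forall>x\<in>N. a \<odot>\<^bsub>M\<^esub> x \<in> N)"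
    using subset one_closed m_closed smult_closed by simp
next
  assume N: "N \<subseteq> carrier M \<and> \<zero>\<^bsub>M\<^esub> \<in> N \<and> (\<forall>x\<in>N. \<forall>y\<in>N. x \<oplus>\<^bsub>M\<^esub> y \<in> N) \<and>
      (\<forall>a\<in>carrier R. \<forall>x\<in>N. a \<odot>\<^bsub>M\<^esub> x \<in> N)"
  have "inv\<^bsub>add_monoid M\<^esub> x \<in> N" if "x \<in> N" for x
  proof -
    have "(\<ominus> \<one>) \<odot>\<^bsub>M\<^esub> x \<in> N" using N that by simp
    moreover have "x \<in> carrier M" using N that by blast
    ultimately have "\<ominus>\<^bsub>M\<^esub> x \<in> N" by (simp add: smult_minus_one)
    then show ?thesis by (simp add: a_inv_def)
  qed
  with N show "submodule N R M"
    by (intro submodule.intro subgroup.intro submodule_axioms.intro) auto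
qed

lemma submodule_diff:
  assumes "submodule N R M" "x \<in> N" "y \<in> N"
  shows "x \<ominus>\<^bsub>M\<^esub> y \<in> N"
proof -
  have "(\<ominus> \<one>) \<odot>\<^bsub>M\<^esub> y \<in> N" "y \<in> carrier M" using assms by (auto simp: submodule_iff)
  then show ?thesis using assms by (auto simp: submodule_iff smult_minus_one a_minus_def)
qed

abbreviation cyclic :: "'c \<Rightarrow> 'c set" where
  "cyclic x \<equiv> (\<lambda>a. a \<odot>\<^bsub>M\<^esub> x) ` carrier R"

lemma submodule_cyclic:
  assumes "x \<in> carrier M"
  shows "submodule (cyclic x) R M" "x \<in> cyclic x"
proof -
  have "a \<odot>\<^bsub>M\<^esub> x \<oplus>\<^bsub>M\<^esub> b \<odot>\<^bsub>M\<^esub> x \<in> cyclic x" "a \<odot>\<^bsub>M\<^esub> (b \<odot>\<^bsub>M\<^esub> x) \<in> cyclic x"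
    if "a \<in> carrier R" "b \<in> carrier R" for a b
    using that assms by (auto simp flip: smult_l_distr smult_assoc)
  moreover have "\<zero>\<^bsub>M\<^esub> \<in> cyclic x"
    using assms by (intro image_eqI[of _ _ \<zero>]) auto
  ultimately show "submodule (cyclic x) R M" using assms by (auto simp: submodule_iff)
  show "x \<in> cyclic x" using assms by (intro image_eqI[of _ _ \<one>]) auto
qed

definition dcc_below :: "'c set \<Rightarrow> bool" where
  "dcc_below H \<longleftrightarrow> (\<forall>N. (\<forall>n::nat. submodule (N n) R M \<and> N n \<subseteq> H \<and> N (Suc n) \<subseteq> N n) \<longrightarrow>
    (\<exists>m. \<forall>n\<ge>m. N n = N m))"

lemma dcc_belowD:
  assumes "dcc_below H" "\<And>n. submodule (N n) R M" "\<And>n. N (Suc n) \<subseteq> N n" "\<And>n. N n \<subseteq> H"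
  obtains m where "\<And>n. n \<ge> m \<Longrightarrow> N n = N m"
proof -
  have "\<exists>m. \<forall>n\<ge>m. N n = N m" using assms unfolding dcc_below_def by blast
  then show ?thesis using that by blast
qed

text \<open>
  A chain below \<open>H + K\<close> is controlled by its intersection with \<open>H\<close> and by the set of \<open>K\<close>-components
  of its members, that is, by its image in the quotient by \<open>H\<close> pulled back to \<open>K\<close>. Once both are constant,
  the modular law gives equality.
\<close>

lemma dcc_below_sum:
  assumes H: "submodule H R M" "dcc_below H" and K: "submodule K R M" "dcc_below K"
  shows "dcc_below (H <+>\<^bsub>M\<^esub> K)"
  unfolding dcc_below_def
proof (intro allI impI)
  fix N :: "nat \<Rightarrow> 'c set"
  assume N: "\<forall>n. submodule (N n) R M \<and> N n \<subseteq> H <+>\<^bsub>M\<^esub> K \<and> N (Suc n) \<subseteq> N n"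
  \<comment> \<open>The members of \<open>K\<close> that represent elements of \<open>N n\<close> modulo \<open>H\<close>.\<close>
  define B where "B n = {b \<in> K. \<exists>a\<in>H. a \<oplus>\<^bsub>M\<^esub> b \<in> N n}" for n
  have mono: "N n \<subseteq> N m" if "m \<le> n" for m n
    using lift_Suc_antimono_le[of N] N that by blast
  have Hc: "H \<subseteq> carrier M" and Kc: "K \<subseteq> carrier M" using H K by (auto simp: submodule_iff)
  have "submodule (N n \<inter> H) R M" for n
    using N H by (auto simp: submodule_iff)
  then obtain m1 where m1: "\<And>n. n \<ge> m1 \<Longrightarrow> N n \<inter> H = N m1 \<inter> H"
    by (rule dcc_belowD[OF H(2), of "\<lambda>n. N n \<inter> H"]) (use N in auto)
  have "submodule (B n) R M" for n
  proof -
    have "b \<oplus>\<^bsub>M\<^esub> b' \<in> B n" if b: "b \<in> B n" and b': "b' \<in> B n" for b b'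
    proof -
      obtain a a' where *: "a \<in> H" "a \<oplus>\<^bsub>M\<^esub> b \<in> N n" "a' \<in> H" "a' \<oplus>\<^bsub>M\<^esub> b' \<in> N n" "b \<in> K" "b' \<in> K"
        using b b' by (auto simp: B_def)
      have "(a \<oplus>\<^bsub>M\<^esub> b) \<oplus>\<^bsub>M\<^esub> (a' \<oplus>\<^bsub>M\<^esub> b') \<in> N n" using N * by (auto simp: submodule_iff)
      also have "(a \<oplus>\<^bsub>M\<^esub> b) \<oplus>\<^bsub>M\<^esub> (a' \<oplus>\<^bsub>M\<^esub> b') = (a \<oplus>\<^bsub>M\<^esub> a') \<oplus>\<^bsub>M\<^esub> (b \<oplus>\<^bsub>M\<^esub> b')"
        using * Hc Kc by (simp add: subset_iff M.a_ac)
      finally show ?thesis using * H K by (auto simp: B_def submodule_iff)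
    qed
    moreover have "c \<odot>\<^bsub>M\<^esub> b \<in> B n" if b: "b \<in> B n" and c: "c \<in> carrier R" for b c
    proof -
      obtain a where *: "a \<in> H" "a \<oplus>\<^bsub>M\<^esub> b \<in> N n" "b \<in> K"
        using b by (auto simp: B_def)
      have "c \<odot>\<^bsub>M\<^esub> (a \<oplus>\<^bsub>M\<^esub> b) \<in> N n" using N * c by (auto simp: submodule_iff)
      also have "c \<odot>\<^bsub>M\<^esub> (a \<oplus>\<^bsub>M\<^esub> b) = c \<odot>\<^bsub>M\<^esub> a \<oplus>\<^bsub>M\<^esub> c \<odot>\<^bsub>M\<^esub> b"
        using * Hc Kc c by (simp add: subset_iff smult_r_distr)
      finally show ?thesis using * H K c by (auto simp: B_def submodule_iff)
    qed
    moreover have "\<zero>\<^bsub>M\<^esub> \<in> B n"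
      using N H K by (auto simp: B_def submodule_iff intro!: bexI[of _ "\<zero>\<^bsub>M\<^esub>"])
    ultimately show ?thesis using Kc by (auto simp: submodule_iff B_def)
  qed
  moreover have "B (Suc n) \<subseteq> B n" for n using N unfolding B_def by blast
  ultimately obtain m2 where m2: "\<And>n. n \<ge> m2 \<Longrightarrow> B n = B m2"
    by (rule dcc_belowD[OF K(2), of B]) (auto simp: B_def)
  have "N m \<subseteq> N n" if m: "m = max m1 m2" and n: "n \<ge> m" for m n
  proof
    fix c assume c: "c \<in> N m"
    then obtain a b where ab: "a \<in> H" "b \<in> K" "c = a \<oplus>\<^bsub>M\<^esub> b"
      using N by (auto simp: set_add_def' dest!: spec[of _ m])
    then have "b \<in> B m" using c by (auto simp: B_def)
    then have "b \<in> B n" using m2[of m] m2[of n] m n by simp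
    then obtain a' where a': "a' \<in> H" "a' \<oplus>\<^bsub>M\<^esub> b \<in> N n" by (auto simp: B_def)
    have cl: "a \<in> carrier M" "a' \<in> carrier M" "b \<in> carrier M" using ab a' Hc Kc by auto
    have eq: "c \<ominus>\<^bsub>M\<^esub> (a' \<oplus>\<^bsub>M\<^esub> b) = a \<ominus>\<^bsub>M\<^esub> a'"
      using cl by (simp add: ab a_minus_def M.minus_add M.a_assoc
          M.a_lcomm[of b "\<ominus>\<^bsub>M\<^esub> a'"] M.r_neg)
    have "a' \<oplus>\<^bsub>M\<^esub> b \<in> N m" using a' mono[OF n] by blast
    then have "c \<ominus>\<^bsub>M\<^esub> (a' \<oplus>\<^bsub>M\<^esub> b) \<in> N m" using N c by (intro submodule_diff) auto
    moreover have "a \<ominus>\<^bsub>M\<^esub> a' \<in> H" using ab a' H by (intro submodule_diff) auto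
    ultimately have "a \<ominus>\<^bsub>M\<^esub> a' \<in> N m \<inter> H" by (simp add: eq)
    then have "a \<ominus>\<^bsub>M\<^esub> a' \<in> N n" using m1[of m] m1[of n] m n by auto
    then have "(a \<ominus>\<^bsub>M\<^esub> a') \<oplus>\<^bsub>M\<^esub> (a' \<oplus>\<^bsub>M\<^esub> b) \<in> N n" using N a' by (auto simp: submodule_iff)
    also have "(a \<ominus>\<^bsub>M\<^esub> a') \<oplus>\<^bsub>M\<^esub> (a' \<oplus>\<^bsub>M\<^esub> b) = c"
      using cl by (simp add: ab a_minus_def M.a_assoc M.r_neg1 M.r_neg2)
    finally show "c \<in> N n" .
  qed
  then have "N n = N (max m1 m2)" if "n \<ge> max m1 m2" for n
    using mono[OF that] that by blast
  then show "\<exists>m. \<forall>n\<ge>m. N n = N m" by blast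
qed

lemma submodule_set_add:
  assumes H: "submodule H R M" and K: "submodule K R M"
  shows "submodule (H <+>\<^bsub>M\<^esub> K) R M" "H \<subseteq> H <+>\<^bsub>M\<^esub> K" "K \<subseteq> H <+>\<^bsub>M\<^esub> K"
proof -
  have Hc: "H \<subseteq> carrier M" and Kc: "K \<subseteq> carrier M" using H K by (auto simp: submodule_iff)
  have 1: "(a \<oplus>\<^bsub>M\<^esub> b) \<oplus>\<^bsub>M\<^esub> (a' \<oplus>\<^bsub>M\<^esub> b') \<in> H <+>\<^bsub>M\<^esub> K"
    if "a \<in> H" "b \<in> K" "a' \<in> H" "b' \<in> K" for a b a' b'
  proof -
    have "(a \<oplus>\<^bsub>M\<^esub> b) \<oplus>\<^bsub>M\<^esub> (a' \<oplus>\<^bsub>M\<^esub> b') = (a \<oplus>\<^bsub>M\<^esub> a') \<oplus>\<^bsub>M\<^esub> (b \<oplus>\<^bsub>M\<^esub> b')"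
      using that Hc Kc by (simp add: subset_iff M.a_ac)
    moreover have "a \<oplus>\<^bsub>M\<^esub> a' \<in> H" "b \<oplus>\<^bsub>M\<^esub> b' \<in> K" using that H K by (auto simp: submodule_iff)
    ultimately show ?thesis unfolding set_add_def' by blast
  qed
  have 2: "c \<odot>\<^bsub>M\<^esub> (a \<oplus>\<^bsub>M\<^esub> b) \<in> H <+>\<^bsub>M\<^esub> K" if "a \<in> H" "b \<in> K" "c \<in> carrier R" for a b c
  proof -
    have "c \<odot>\<^bsub>M\<^esub> (a \<oplus>\<^bsub>M\<^esub> b) = c \<odot>\<^bsub>M\<^esub> a \<oplus>\<^bsub>M\<^esub> c \<odot>\<^bsub>M\<^esub> b"
      using that Hc Kc by (simp add: subset_iff smult_r_distr)
    moreover have "c \<odot>\<^bsub>M\<^esub> a \<in> H" "c \<odot>\<^bsub>M\<^esub> b \<in> K" using that H K by (auto simp: submodule_iff)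
    ultimately show ?thesis unfolding set_add_def' by blast
  qed
  have 0: "\<zero>\<^bsub>M\<^esub> \<in> H" "\<zero>\<^bsub>M\<^esub> \<in> K" using H K by (auto simp: submodule_iff)
  have "a \<in> H <+>\<^bsub>M\<^esub> K" if "a \<in> H" for a
  proof -
    have "a = a \<oplus>\<^bsub>M\<^esub> \<zero>\<^bsub>M\<^esub>" using that Hc by auto
    then show ?thesis using that 0 unfolding set_add_def' by blast
  qed
  then show H': "H \<subseteq> H <+>\<^bsub>M\<^esub> K" by blast
  have "b \<in> H <+>\<^bsub>M\<^esub> K" if "b \<in> K" for b
  proof -
    have "b = \<zero>\<^bsub>M\<^esub> \<oplus>\<^bsub>M\<^esub> b" using that Kc by auto
    then show ?thesis using that 0 unfolding set_add_def' by blast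
  qed
  then show "K \<subseteq> H <+>\<^bsub>M\<^esub> K" by blast
  have "H <+>\<^bsub>M\<^esub> K \<subseteq> carrier M" using Hc Kc by (auto simp: set_add_def')
  moreover have "\<forall>x\<in>H <+>\<^bsub>M\<^esub> K. \<forall>y\<in>H <+>\<^bsub>M\<^esub> K. x \<oplus>\<^bsub>M\<^esub> y \<in> H <+>\<^bsub>M\<^esub> K"
    "\<forall>c\<in>carrier R. \<forall>x\<in>H <+>\<^bsub>M\<^esub> K. c \<odot>\<^bsub>M\<^esub> x \<in> H <+>\<^bsub>M\<^esub> K"
    using 1 2 by (auto simp: set_add_def'[of M H K])
  ultimately show "submodule (H <+>\<^bsub>M\<^esub> K) R M"
    using 0 H' by (auto simp: submodule_iff)
qed

end

lemma submodule_submodule_span: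
  fixes M :: "('a, 'b) module"
  assumes "left_module R M" "S \<subseteq> carrier M"
  shows "submodule (submodule_span R M S) R M"
proof -
  interpret left_module R M by fact
  have "submodule (carrier M) R M" by (simp add: submodule_iff)
  with assms(2) show ?thesis
    unfolding submodule_span_def by (auto simp: submodule_iff)
qed

text \<open>
  A finitely generated submodule is contained in a finite sum of cyclic ones.
\<close>

lemma locally_artinianI:
  fixes M :: "('a, 'b) module"
  assumes "left_module R M"
    and dcc: "\<And>x. x \<in> carrier M \<Longrightarrow>
      left_module.dcc_below R M ((\<lambda>a. a \<odot>\<^bsub>M\<^esub> x) ` carrier R)"
  shows "locally_artinian R M"
proof -
  interpret left_module R M by fact
  have *: "\<exists>H. submodule H R M \<and> S \<subseteq> H \<and> dcc_below H" if "finite S" "S \<subseteq> carrier M" for S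
    using that
  proof (induction S)
    case empty
    have "submodule {\<zero>\<^bsub>M\<^esub>} R M" by (simp add: submodule_iff)
    moreover have "dcc_below {\<zero>\<^bsub>M\<^esub>}"
      unfolding dcc_below_def
    proof (intro allI impI)
      fix N :: "nat \<Rightarrow> 'b set"
      assume "\<forall>n. submodule (N n) R M \<and> N n \<subseteq> {\<zero>\<^bsub>M\<^esub>} \<and> N (Suc n) \<subseteq> N n"
      then have "N n = {\<zero>\<^bsub>M\<^esub>}" for n by (auto simp: submodule_iff)
      then show "\<exists>m. \<forall>n\<ge>m. N n = N m" by simp
    qed
    ultimately show ?case by blast
  next
    case (insert x S)
    then obtain H where H: "submodule H R M" "S \<subseteq> H" "dcc_below H" by auto
    have x: "x \<in> carrier M" using insert.prems by simp
    note c = submodule_cyclic[OF x]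
    show ?case
      using submodule_set_add[OF c(1) H(1)] dcc_below_sum[OF c(1) dcc[OF x] H(1,3)] c(2) H(2)
      by blast
  qed
  have "artinian_module R (M\<lparr>carrier := submodule_span R M S\<rparr>)"
    if S: "finite S" "S \<subseteq> carrier M" for S
  proof -
    let ?L = "submodule_span R M S"
    have L: "submodule ?L R M" using left_module_axioms S(2) by (rule submodule_submodule_span)
    then have lm: "left_module R (M\<lparr>carrier := ?L\<rparr>)"
      by (intro submodule_left_moduleI) (auto simp: submodule_iff)
    obtain H where H: "submodule H R M" "S \<subseteq> H" "dcc_below H" using *[OF S] by blast
    then have "?L \<subseteq> H" unfolding submodule_span_def by blast
    have sub: "submodule N R M \<and> N \<subseteq> H" if "submodule N R (M\<lparr>carrier := ?L\<rparr>)" for N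
      using that L \<open>?L \<subseteq> H\<close> unfolding left_module.submodule_iff[OF lm] submodule_iff by auto
    show ?thesis
      unfolding artinian_module_def
    proof (intro conjI lm allI impI)
      fix N :: "nat \<Rightarrow> 'b set"
      assume N: "(\<forall>n. submodule (N n) R (M\<lparr>carrier := ?L\<rparr>)) \<and> (\<forall>n. N (Suc n) \<subseteq> N n)"
      have "submodule (N n) R M" "N n \<subseteq> H" "N (Suc n) \<subseteq> N n" for n
        using N sub[of "N n"] by simp_all
      then obtain m where "\<And>n. n \<ge> m \<Longrightarrow> N n = N m"
        using dcc_belowD[OF H(3), of N] by metis
      then show "\<exists>m. \<forall>n\<ge>m. N n = N m" by blast
    qed
  qed
  then show ?thesis unfolding locally_artinian_def using left_module_axioms by blast
qed

section \<open>The normal element X and unit leading coefficients\<close>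

context fps_automorphism
begin

lemma lead_coeff_unit_cong:
  fixes p q :: "'k fps poly"
  assumes "\<And>i. coeff q i = coeff p i * g i" "\<And>i. g i $ 0 \<noteq> 0" "lead_coeff p $ 0 \<noteq> 0"
  shows "lead_coeff q $ 0 \<noteq> 0"
proof -
  have "coeff q i = 0 \<longleftrightarrow> coeff p i = 0" for i
    using assms(2)[of i] by (auto simp: assms(1))
  then have "degree q = degree p" unfolding degree_def by simp
  then show ?thesis using assms by simp
qed

lemma lead_coeff_unit_skew:
  assumes "lead_coeff p $ 0 \<noteq> 0" "lead_coeff q $ 0 \<noteq> 0"
  shows "lead_coeff (p \<star> q) $ 0 \<noteq> 0"
proof -
  have "p \<noteq> 0" "q \<noteq> 0" using assms by auto
  then show ?thesis using assms by (simp add: degree_lead_coeff_skew(2) pow_alpha_nth_0)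
qed

lemma skew_commute_mod_X: "[:fps_X:] dvd p \<star> q - q \<star> p"
proof -
  have "coeff (p \<star> q) n $ 0 = coeff (q \<star> p) n $ 0" for n
    unfolding coeff_skew fps_sum_nth
    by (rule sum.reindex_bij_witness[of _ "\<lambda>i. n - i" "\<lambda>i. n - i"])
      (auto simp: pow_alpha_nth_0 mult.commute)
  then show ?thesis by (simp add: const_poly_dvd_iff X_dvd_nth)
qed

lemma X_skew: obtains q where "[:fps_X:] \<star> p = q \<star> [:fps_X:]"
  using X_power_skew[of 1 p] by (simp add: const_skew) metis

lemma skew_X: obtains q where "p \<star> [:fps_X:] = [:fps_X:] \<star> q"
  using skew_X_power[of p 1] by (simp add: const_skew) metis

lemma X_dvdE:
  assumes "[:fps_X:] dvd p"
  obtains q where "p = [:fps_X:] \<star> q"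
  using X_power_dvdE[of 1 p] assms by (simp add: const_skew) metis

text \<open>
  The valuation of the leading coefficient bounds the number of factors \<open>X\<close> that can be split off.
\<close>

lemma primitive_part:
  fixes f :: "'k fps poly"
  assumes "f \<noteq> 0"
  obtains n g i where "f = smult (fps_X ^ n) g" "coeff g i $ 0 \<noteq> 0"
proof -
  have "\<exists>n g i. f = smult (fps_X ^ n) g \<and> coeff g i $ 0 \<noteq> 0"
    using assms
  proof (induction "subdegree (lead_coeff f)" arbitrary: f rule: less_induct)
    case less
    show ?case
    proof (cases "\<exists>i. coeff f i $ 0 \<noteq> 0")
      case True
      then obtain i where "coeff f i $ 0 \<noteq> 0" by blast
      then show ?thesis by (intro exI[of _ 0] exI[of _ f] exI[of _ i]) simp
    next
      case False
      then have "[:fps_X:] dvd f" by (simp add: const_poly_dvd_iff X_dvd_nth)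
      then obtain g where g: "f = smult fps_X g" by (rule X_dvdE) (simp add: const_skew)
      then have "g \<noteq> 0" using less.prems by auto
      moreover from this have "subdegree (lead_coeff g) < subdegree (lead_coeff f)" by (simp add: g)
      ultimately obtain n h i where "g = smult (fps_X ^ n) h" "coeff h i $ 0 \<noteq> 0"
        using less.hyps by blast
      then show ?thesis by (intro exI[of _ "Suc n"] exI[of _ h] exI[of _ i]) (simp add: g)
    qed
  qed
  then show ?thesis using that by blast
qed

end

section \<open>Modules over the skew polynomial ring\<close>

locale skew_poly_module =
  fps_automorphism \<alpha> + left_module "skew_poly_ring \<alpha>" E
  for \<alpha> :: "'k::field fps \<Rightarrow> 'k fps" and E :: "('k fps poly, 'e) module"
begin

abbreviation act (infixr "\<bullet>" 75) where "s \<bullet> x \<equiv> s \<odot>\<^bsub>E\<^esub> x"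
abbreviation zero_E ("\<zero>\<^sub>E") where "\<zero>\<^sub>E \<equiv> \<zero>\<^bsub>E\<^esub>"

lemma act_closed [simp]: "x \<in> carrier E \<Longrightarrow> s \<bullet> x \<in> carrier E"
  and act_skew: "x \<in> carrier E \<Longrightarrow> (s \<star> t) \<bullet> x = s \<bullet> (t \<bullet> x)"
  and act_add: "x \<in> carrier E \<Longrightarrow> (s + t) \<bullet> x = s \<bullet> x \<oplus>\<^bsub>E\<^esub> t \<bullet> x"
  and act_1 [simp]: "x \<in> carrier E \<Longrightarrow> 1 \<bullet> x = x"
  and act_0 [simp]: "x \<in> carrier E \<Longrightarrow> 0 \<bullet> x = \<zero>\<^sub>E"
  and act_zero [simp]: "s \<bullet> \<zero>\<^sub>E = \<zero>\<^sub>E"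
  and act_add_right: "x \<in> carrier E \<Longrightarrow> y \<in> carrier E \<Longrightarrow> s \<bullet> (x \<oplus>\<^bsub>E\<^esub> y) = s \<bullet> x \<oplus>\<^bsub>E\<^esub> s \<bullet> y"
  using smult_closed[of s x] smult_assoc[of s t x] smult_l_distr[of s t x] smult_one[of x]
    smult_l_null[of x] smult_r_null[of s] smult_r_distr[of s x y] by simp_all

lemma act_diff_eq_0_iff:
  assumes "x \<in> carrier E"
  shows "(s - t) \<bullet> x = \<zero>\<^sub>E \<longleftrightarrow> s \<bullet> x = t \<bullet> x"
proof -
  have "s \<bullet> x = (s - t) \<bullet> x \<oplus>\<^bsub>E\<^esub> t \<bullet> x" using act_add[OF assms, of "s - t" t] by simp
  then show ?thesis using assms M.add.r_cancel_one[of "t \<bullet> x" "(s - t) \<bullet> x"] by auto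
qed

lemma left_ideal_preimage:
  assumes N: "submodule N (skew_poly_ring \<alpha>) E" and x: "x \<in> carrier E"
  shows "left_ideal {s. s \<bullet> x \<in> N}"
  using N x by (auto simp: left_ideal_def submodule_iff act_add act_skew)

text \<open>
  A submodule of \<open>S x\<close> is the image of the left ideal of all \<open>s\<close> with \<open>s x\<close> in it, so that chains of
  submodules of \<open>S x\<close> can be studied through chains of left ideals.
\<close>

lemma stable_if_preimage_stable:
  assumes N: "\<And>n. N n \<subseteq> range (\<lambda>s. s \<bullet> x)"
    and stable: "\<exists>m. \<forall>n\<ge>m::nat. {s. s \<bullet> x \<in> N n} = {s. s \<bullet> x \<in> N m}"
  shows "\<exists>m. \<forall>n\<ge>m. N n = N m"
proof -
  have image: "(\<lambda>s. s \<bullet> x) ` {s. s \<bullet> x \<in> N n} = N n" for n using N[of n] by blast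
  obtain m where m: "\<And>n. n \<ge> m \<Longrightarrow> {s. s \<bullet> x \<in> N n} = {s. s \<bullet> x \<in> N m}"
    using stable by blast
  have "N n = N m" if "n \<ge> m" for n
    using arg_cong[OF m[OF that], of "\<lambda>S. (\<lambda>s. s \<bullet> x) ` S"] by (simp only: image)
  then show ?thesis by blast
qed

lemma submodule_acc:
  assumes x: "x \<in> carrier E" and N: "\<And>n. submodule (N n) (skew_poly_ring \<alpha>) E"
    "\<And>n. N n \<subseteq> range (\<lambda>s. s \<bullet> x)" "\<And>n::nat. N n \<subseteq> N (Suc n)"
  shows "\<exists>m. \<forall>n\<ge>m. N n = N m"
proof -
  have "\<exists>m. \<forall>n\<ge>m. {s. s \<bullet> x \<in> N n} = {s. s \<bullet> x \<in> N m}"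
    using N(3) by (intro left_ideal_acc left_ideal_preimage N x) blast
  with N(2) show ?thesis by (rule stable_if_preimage_stable)
qed

lemma X_multiple_kills:
  assumes "[:fps_X:] dvd q" "w \<in> carrier E" "[:fps_X:] \<bullet> w = \<zero>\<^sub>E"
  shows "q \<bullet> w = \<zero>\<^sub>E"
proof -
  obtain r where "q = [:fps_X:] \<star> r" using assms(1) by (rule X_dvdE)
  moreover obtain s where "[:fps_X:] \<star> r = s \<star> [:fps_X:]" by (rule X_skew)
  ultimately show ?thesis using assms by (simp add: act_skew)
qed

text \<open>
  On an element killed by \<open>X\<close> only the reduction of \<open>q\<close> modulo \<open>X\<close> matters. Top terms whose coefficient
  is not a unit can therefore be dropped.
\<close>

lemma unit_lead_annihilator:
  assumes "coeff q i $ 0 \<noteq> 0" "q \<bullet> w = \<zero>\<^sub>E" "w \<in> carrier E" "[:fps_X:] \<bullet> w = \<zero>\<^sub>E"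
  shows "\<exists>p. lead_coeff p $ 0 \<noteq> 0 \<and> p \<bullet> w = \<zero>\<^sub>E"
  using assms(1,2)
proof (induction "degree q" arbitrary: q rule: less_induct)
  case less
  show ?case
  proof (cases "lead_coeff q $ 0 = 0")
    case True
    let ?m = "monom (lead_coeff q) (degree q)"
    have "[:fps_X:] dvd ?m" using True by (simp add: const_poly_dvd_iff X_dvd_nth)
    then have "?m \<bullet> w = \<zero>\<^sub>E" using assms(3,4) by (rule X_multiple_kills)
    then have kill: "(q - ?m) \<bullet> w = \<zero>\<^sub>E" using less.prems(2) assms(3) by (simp add: act_diff_eq_0_iff)
    have coeff: "coeff (q - ?m) i $ 0 \<noteq> 0" using less.prems(1) True by auto
    have "coeff (q - ?m) j = 0" if "j \<ge> degree q" for j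
      using that by (cases "j = degree q") (auto simp: coeff_eq_0)
    moreover have "q - ?m \<noteq> 0" using coeff by (auto simp del: coeff_diff)
    then have "lead_coeff (q - ?m) \<noteq> 0" by (simp only: leading_coeff_0_iff not_False_eq_True)
    ultimately have "degree (q - ?m) < degree q" using not_le by blast
    then show ?thesis using less.hyps coeff kill by blast
  qed (use less.prems in blast)
qed

lemma X_power_act:
  fixes n :: nat
  assumes "x \<in> carrier E"
  shows "((\<lambda>y. [:fps_X:] \<bullet> y) ^^ n) x = [:fps_X ^ n:] \<bullet> x"
proof (induction n)
  case 0
  then show ?case using assms by (simp add: pCons_one)
next
  case (Suc n)
  have "[:fps_X:] \<star> [:fps_X ^ n:] = [:fps_X ^ Suc n:]" by (simp add: const_skew)
  then show ?case using Suc assms by (simp flip: act_skew)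
qed

end

section \<open>Modules with a monolith\<close>

text \<open>
  The element \<open>v\<close> generates a smallest nonzero submodule. For an essential extension of a simple
  module every nonzero element of the simple module is such a \<open>v\<close>.
\<close>

locale monolithic_skew_poly_module = skew_poly_module +
  fixes v
  assumes v: "v \<in> carrier E" "v \<noteq> \<zero>\<^sub>E"
    and v_in_cyclic: "\<And>x. x \<in> carrier E \<Longrightarrow> x \<noteq> \<zero>\<^sub>E \<Longrightarrow> \<exists>s. v = s \<bullet> x"
begin

text \<open>
  The argument behind Fitting's lemma. The submodules of \<open>S x\<close> killed by \<open>z\<^sup>n\<close> ascend, hence are
  constant from some \<open>m\<close> on. If \<open>z\<^sup>m x\<close> were nonzero, the image \<open>z\<^sup>m S x\<close> would contain \<open>v\<close>; a preimage
  of \<open>v\<close> is killed by \<open>z\<^sup>m\<^sup>+\<^sup>1\<close>, hence by \<open>z\<^sup>m\<close>, and \<open>v\<close> would be zero. The two commutation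
  hypotheses, which make kernels and images submodules, are required on \<open>S x\<close> only: for the second
  use of the lemma \<open>z\<close> is central just modulo \<open>X\<close>.
\<close>

lemma normal_action_nilpotent:
  fixes z :: "'a fps poly"
  assumes x: "x \<in> carrier E"
    and right: "\<And>s. \<exists>s'. \<forall>t. z \<bullet> (s \<bullet> (t \<bullet> x)) = s' \<bullet> (z \<bullet> (t \<bullet> x))"
    and left: "\<And>s. \<exists>s'. \<forall>t. s \<bullet> (z \<bullet> (t \<bullet> x)) = z \<bullet> (s' \<bullet> (t \<bullet> x))"
    and zv: "z \<bullet> v = \<zero>\<^sub>E"
  shows "\<exists>n. ((\<lambda>y. z \<bullet> y) ^^ n) x = \<zero>\<^sub>E"
proof -
  let ?T = "\<lambda>n. (\<lambda>y. z \<bullet> y) ^^ n"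
  have T_cyclic: "\<exists>t'. ?T n (t \<bullet> x) = t' \<bullet> x" for n t
  proof (induction n)
    case (Suc n)
    then obtain t' where "?T n (t \<bullet> x) = t' \<bullet> x" by blast
    then have "?T (Suc n) (t \<bullet> x) = (z \<star> t') \<bullet> x" using x by (simp add: act_skew)
    then show ?case by blast
  qed auto
  have T_closed: "y \<in> carrier E \<Longrightarrow> ?T n y \<in> carrier E" for n y by (induction n) simp_all
  have T_0: "?T n \<zero>\<^sub>E = \<zero>\<^sub>E" for n by (induction n) simp_all
  have T_add: "?T n (a \<oplus>\<^bsub>E\<^esub> b) = ?T n a \<oplus>\<^bsub>E\<^esub> ?T n b" if "a \<in> carrier E" "b \<in> carrier E" for n a b
    by (induction n) (simp_all add: that act_add_right T_closed)
  have T_right: "\<exists>s'. \<forall>t. ?T n (s \<bullet> (t \<bullet> x)) = s' \<bullet> ?T n (t \<bullet> x)" for n s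
  proof (induction n)
    case (Suc n)
    then obtain s' where s': "\<And>t. ?T n (s \<bullet> (t \<bullet> x)) = s' \<bullet> ?T n (t \<bullet> x)" by blast
    obtain s'' where s'': "\<And>t. z \<bullet> (s' \<bullet> (t \<bullet> x)) = s'' \<bullet> (z \<bullet> (t \<bullet> x))" using right by blast
    have "?T (Suc n) (s \<bullet> (t \<bullet> x)) = s'' \<bullet> ?T (Suc n) (t \<bullet> x)" for t
      using T_cyclic[of n t] s'' by (auto simp: s')
    then show ?case by blast
  qed auto
  have T_left: "\<exists>s'. \<forall>t. s \<bullet> ?T n (t \<bullet> x) = ?T n (s' \<bullet> (t \<bullet> x))" for n s
  proof (induction n arbitrary: s)
    case (Suc n)
    obtain s' where s': "\<And>t. s \<bullet> (z \<bullet> (t \<bullet> x)) = z \<bullet> (s' \<bullet> (t \<bullet> x))" using left by blast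
    obtain s'' where s'': "\<And>t. s' \<bullet> ?T n (t \<bullet> x) = ?T n (s'' \<bullet> (t \<bullet> x))" using Suc by blast
    have "s \<bullet> ?T (Suc n) (t \<bullet> x) = ?T (Suc n) (s'' \<bullet> (t \<bullet> x))" for t
      using T_cyclic[of n t] s' s''[of t] by auto
    then show ?case by blast
  qed auto
  define I where "I n = {s. ?T n (s \<bullet> x) = \<zero>\<^sub>E}" for n
  have "left_ideal (I n)" for n
    unfolding left_ideal_def
  proof (intro conjI ballI allI)
    show "0 \<in> I n" using x by (simp add: I_def T_0)
    show "f + g \<in> I n" if "f \<in> I n" "g \<in> I n" for f g
      using that x by (simp add: I_def act_add T_add)
    show "s \<star> f \<in> I n" if "f \<in> I n" for s f
    proof -
      obtain s' where "\<And>t. ?T n (s \<bullet> (t \<bullet> x)) = s' \<bullet> ?T n (t \<bullet> x)" using T_right by blast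
      then show ?thesis using that x by (simp add: I_def act_skew)
    qed
  qed
  moreover have "I n \<subseteq> I (Suc n)" for n by (auto simp: I_def)
  ultimately obtain m where m: "\<And>n. n \<ge> m \<Longrightarrow> I n = I m" using left_ideal_acc by metis
  have "?T m x = \<zero>\<^sub>E"
  proof (rule ccontr)
    assume "?T m x \<noteq> \<zero>\<^sub>E"
    then obtain s where s: "v = s \<bullet> ?T m (1 \<bullet> x)"
      using v_in_cyclic[OF T_closed[OF x]] x by auto
    obtain s' where "s \<bullet> ?T m (1 \<bullet> x) = ?T m (s' \<bullet> (1 \<bullet> x))" using T_left by blast
    then have v': "v = ?T m (s' \<bullet> x)" using s x by simp
    then have "s' \<in> I (Suc m)" using zv by (simp add: I_def)
    then have "s' \<in> I m" using m[of "Suc m"] by simp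
    then show False using v' v(2) by (simp add: I_def)
  qed
  then show ?thesis by blast
qed

section \<open>The case of a monolith killed by X\<close>

lemma X_power_torsion:
  assumes x: "x \<in> carrier E" and Xv: "[:fps_X:] \<bullet> v = \<zero>\<^sub>E"
  shows "\<exists>n. [:fps_X ^ n:] \<bullet> x = \<zero>\<^sub>E"
proof -
  have "\<exists>s'. \<forall>t. [:fps_X:] \<bullet> (s \<bullet> (t \<bullet> x)) = s' \<bullet> ([:fps_X:] \<bullet> (t \<bullet> x))" for s
  proof -
    obtain s' where s': "[:fps_X:] \<star> s = s' \<star> [:fps_X:]" by (rule X_skew)
    have "[:fps_X:] \<bullet> (s \<bullet> (t \<bullet> x)) = s' \<bullet> ([:fps_X:] \<bullet> (t \<bullet> x))" for t
      using x arg_cong[OF s', of "\<lambda>p. p \<bullet> (t \<bullet> x)"] by (simp add: act_skew)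
    then show ?thesis by blast
  qed
  moreover have "\<exists>s'. \<forall>t. s \<bullet> ([:fps_X:] \<bullet> (t \<bullet> x)) = [:fps_X:] \<bullet> (s' \<bullet> (t \<bullet> x))" for s
  proof -
    obtain s' where s': "s \<star> [:fps_X:] = [:fps_X:] \<star> s'" by (rule skew_X)
    have "s \<bullet> ([:fps_X:] \<bullet> (t \<bullet> x)) = [:fps_X:] \<bullet> (s' \<bullet> (t \<bullet> x))" for t
      using x arg_cong[OF s', of "\<lambda>p. p \<bullet> (t \<bullet> x)"] by (simp add: act_skew)
    then show ?thesis by blast
  qed
  ultimately have "\<exists>n. ((\<lambda>y. [:fps_X:] \<bullet> y) ^^ n) x = \<zero>\<^sub>E"
    by (rule normal_action_nilpotent[OF x _ _ Xv])
  then show ?thesis by (simp only: X_power_act[OF x])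
qed

text \<open>
  The simple module generated by \<open>v\<close> is a module over a polynomial ring over a field, hence not free:
  either \<open>\<theta> v = 0\<close>, or \<open>v\<close> is in \<open>S \<theta> v\<close> and \<open>1 - q \<theta>\<close> kills it for some \<open>q\<close>.
\<close>

lemma unit_lead_annihilator_v:
  assumes Xv: "[:fps_X:] \<bullet> v = \<zero>\<^sub>E"
  obtains p where "lead_coeff p $ 0 \<noteq> 0" "p \<bullet> v = \<zero>\<^sub>E"
proof (cases "monom 1 1 \<bullet> v = \<zero>\<^sub>E")
  case True
  then show ?thesis using that[of "monom 1 1"] by (simp add: degree_monom_eq)
next
  case False
  then obtain q where q: "v = q \<bullet> (monom 1 1 \<bullet> v)" using v_in_cyclic[OF act_closed[OF v(1)]] by blast
  have "(1 - q \<star> monom 1 1) \<bullet> v = \<zero>\<^sub>E"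
    unfolding act_diff_eq_0_iff[OF v(1)] act_skew[OF v(1)] q[symmetric] using v(1) by (rule act_1)
  moreover have "coeff (1 - q \<star> monom 1 1) 0 $ 0 \<noteq> 0" by (simp add: coeff_skew_monom)
  ultimately show ?thesis using unit_lead_annihilator v(1) Xv that by blast
qed

text \<open>
  A polynomial \<open>p\<close> that kills \<open>v\<close> commutes with all of \<open>S\<close> on the elements killed by \<open>X\<close>, so it acts
  nilpotently on each of them, and powers of \<open>p\<close> inherit the unit leading coefficient.
\<close>

lemma unit_lead_annihilator_of_X_torsion:
  assumes w: "w \<in> carrier E" "[:fps_X:] \<bullet> w = \<zero>\<^sub>E" and Xv: "[:fps_X:] \<bullet> v = \<zero>\<^sub>E"
  shows "\<exists>h. lead_coeff h $ 0 \<noteq> 0 \<and> h \<bullet> w = \<zero>\<^sub>E"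
proof -
  obtain p where p: "lead_coeff p $ 0 \<noteq> 0" "p \<bullet> v = \<zero>\<^sub>E"
    using Xv by (rule unit_lead_annihilator_v)
  have X: "[:fps_X:] \<bullet> (t \<bullet> w) = \<zero>\<^sub>E" for t
  proof -
    have "([:fps_X:] \<star> t) \<bullet> w = \<zero>\<^sub>E"
      by (rule X_multiple_kills[OF _ w]) (simp add: const_skew const_poly_dvd_iff)
    then show ?thesis using w(1) by (simp only: act_skew)
  qed
  have comm: "p \<bullet> (s \<bullet> (t \<bullet> w)) = s \<bullet> (p \<bullet> (t \<bullet> w))" for s t
    using X_multiple_kills[OF skew_commute_mod_X, of "t \<bullet> w" p s] X w(1)
    by (simp add: act_diff_eq_0_iff act_skew)
  have "\<exists>n. ((\<lambda>y. p \<bullet> y) ^^ n) w = \<zero>\<^sub>E"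
    by (rule normal_action_nilpotent[OF w(1) _ _ p(2)]) (use comm in metis)+
  then obtain n where n: "((\<lambda>y. p \<bullet> y) ^^ n) w = \<zero>\<^sub>E" by blast
  have "\<exists>h. lead_coeff h $ 0 \<noteq> 0 \<and> ((\<lambda>y. p \<bullet> y) ^^ n) w = h \<bullet> w" for n
  proof (induction n)
    case 0
    then show ?case using w(1) by (intro exI[of _ 1]) simp
  next
    case (Suc n)
    then obtain h where "lead_coeff h $ 0 \<noteq> 0" "((\<lambda>y. p \<bullet> y) ^^ n) w = h \<bullet> w" by blast
    then show ?case
      using p(1) w(1) by (intro exI[of _ "p \<star> h"]) (simp add: lead_coeff_unit_skew act_skew)
  qed
  from this[of n] obtain h where "lead_coeff h $ 0 \<noteq> 0" "\<zero>\<^sub>E = h \<bullet> w" unfolding n by blast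
  then show ?thesis by (intro exI[of _ h]) simp
qed

text \<open>
  Induction on \<open>n\<close>. If \<open>p\<close> kills \<open>X\<^sup>n x\<close>, moving \<open>X\<^sup>n\<close> to the left turns \<open>p\<close> into a polynomial \<open>p'\<close>, again
  with a unit leading coefficient, for which \<open>X\<^sup>n\<close> kills \<open>p' x\<close>.
\<close>

lemma unit_lead_annihilator_of_X_power_torsion:
  assumes "x \<in> carrier E" "[:fps_X ^ n:] \<bullet> x = \<zero>\<^sub>E" and Xv: "[:fps_X:] \<bullet> v = \<zero>\<^sub>E"
  shows "\<exists>h. lead_coeff h $ 0 \<noteq> 0 \<and> h \<bullet> x = \<zero>\<^sub>E"
  using assms(1,2)
proof (induction n arbitrary: x)
  case 0
  then show ?case by (intro exI[of _ 1]) (simp add: pCons_one)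
next
  case (Suc n)
  let ?w = "[:fps_X ^ n:] \<bullet> x"
  have "[:fps_X:] \<star> [:fps_X ^ n:] = [:fps_X ^ Suc n:]" by (simp add: const_skew)
  then have "[:fps_X:] \<bullet> ?w = \<zero>\<^sub>E" using Suc.prems by (simp flip: act_skew)
  then obtain p where p: "lead_coeff p $ 0 \<noteq> 0" "p \<bullet> ?w = \<zero>\<^sub>E"
    using unit_lead_annihilator_of_X_torsion[of ?w] Suc.prems(1) Xv by auto
  obtain p' g where p': "p \<star> [:fps_X ^ n:] = smult (fps_X ^ n) p'"
      "\<And>i. coeff p' i = coeff p i * g i" "\<And>i. g i $ 0 \<noteq> 0"
    using skew_X_power[of p n] by metis
  have "[:fps_X ^ n:] \<bullet> (p' \<bullet> x) = \<zero>\<^sub>E"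
    using p(2) p'(1) Suc.prems(1) by (simp add: const_skew flip: act_skew)
  then obtain h where h: "lead_coeff h $ 0 \<noteq> 0" "h \<bullet> (p' \<bullet> x) = \<zero>\<^sub>E"
    using Suc.IH[of "p' \<bullet> x"] Suc.prems(1) by auto
  have "lead_coeff p' $ 0 \<noteq> 0" using p'(2,3) p(1) by (rule lead_coeff_unit_cong)
  then show ?case
    using h Suc.prems(1) by (intro exI[of _ "h \<star> p'"]) (simp add: lead_coeff_unit_skew act_skew)
qed

lemma dcc_cyclic_X_torsion:
  assumes x: "x \<in> carrier E" and Xv: "[:fps_X:] \<bullet> v = \<zero>\<^sub>E"
  shows "dcc_below (range (\<lambda>s. s \<bullet> x))"
  unfolding dcc_below_def
proof (intro allI impI)
  fix N :: "nat \<Rightarrow> 'b set"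
  assume "\<forall>n. submodule (N n) (skew_poly_ring \<alpha>) E \<and> N n \<subseteq> range (\<lambda>s. s \<bullet> x) \<and> N (Suc n) \<subseteq> N n"
  then have N: "\<And>n. submodule (N n) (skew_poly_ring \<alpha>) E" "\<And>n. N n \<subseteq> range (\<lambda>s. s \<bullet> x)"
    "\<And>n. N (Suc n) \<subseteq> N n" by blast+
  obtain e where e: "[:fps_X ^ e:] \<bullet> x = \<zero>\<^sub>E" using X_power_torsion[OF x Xv] by blast
  obtain h where h: "lead_coeff h $ 0 \<noteq> 0" "h \<bullet> x = \<zero>\<^sub>E"
    using unit_lead_annihilator_of_X_power_torsion[OF x e Xv] by blast
  have z: "\<zero>\<^sub>E \<in> N n" for n using N(1)[of n] by (simp add: submodule_iff)
  have "\<exists>m. \<forall>n\<ge>m. {s. s \<bullet> x \<in> N n} = {s. s \<bullet> x \<in> N m}"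
    using N(3) e h z by (intro left_ideal_dcc[of _ e h] left_ideal_preimage N x) auto
  with N(2) show "\<exists>m. \<forall>n\<ge>m. N n = N m" by (rule stable_if_preimage_stable)
qed

section \<open>The case of a monolith not killed by X\<close>

text \<open>
  If \<open>X\<close> kills a nonzero element, it kills the submodule generated by it, by normality, and \<open>v\<close> is in
  that submodule.
\<close>

lemma X_injective:
  assumes Xv: "[:fps_X:] \<bullet> v \<noteq> \<zero>\<^sub>E" and x: "x \<in> carrier E" "[:fps_X ^ n:] \<bullet> x = \<zero>\<^sub>E"
  shows "x = \<zero>\<^sub>E"
  using x
proof (induction n)
  case 0
  then show ?case by (simp add: pCons_one)
next
  case (Suc n)
  let ?y = "[:fps_X ^ n:] \<bullet> x"
  have "[:fps_X:] \<star> [:fps_X ^ n:] = [:fps_X ^ Suc n:]" by (simp add: const_skew)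
  then have Xy: "[:fps_X:] \<bullet> ?y = \<zero>\<^sub>E" using Suc.prems by (simp flip: act_skew)
  have "?y = \<zero>\<^sub>E"
  proof (rule ccontr)
    assume "?y \<noteq> \<zero>\<^sub>E"
    then obtain s where s: "v = s \<bullet> ?y"
      using v_in_cyclic[OF act_closed[OF Suc.prems(1)]] by blast
    have "([:fps_X:] \<star> s) \<bullet> ?y = \<zero>\<^sub>E"
      using X_multiple_kills[of "[:fps_X:] \<star> s" ?y] Xy Suc.prems(1)
      by (simp add: const_skew const_poly_dvd_iff)
    then show False using Xv s Suc.prems(1) by (simp add: act_skew)
  qed
  then show ?case using Suc by simp
qed

text \<open>
  With \<open>f = X\<^sup>n g\<close> and \<open>v = X s v\<close>, moving \<open>X\<^sup>n\<close> to the left and cancelling it gives that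
  \<open>(1 - X r) g\<close> kills \<open>y\<close> for some \<open>r\<close>. This polynomial has the same reduction modulo \<open>X\<close> as \<open>g\<close>, which is
  nonzero and of degree at most that of \<open>f\<close>, so that Hensel factorization applies.
\<close>

lemma annihilator_factorization:
  assumes Xv: "[:fps_X:] \<bullet> v \<noteq> \<zero>\<^sub>E" and y: "y \<in> carrier E" "f \<bullet> y = v"
  obtains w u where "lead_coeff w $ 0 \<noteq> 0" "degree w \<le> degree f" "[:fps_X:] dvd u - 1"
    "w \<bullet> (u \<bullet> y) = \<zero>\<^sub>E"
proof -
  have "f \<noteq> 0" using y v(2) by auto
  then obtain n g i where g: "f = smult (fps_X ^ n) g" "coeff g i $ 0 \<noteq> 0" by (rule primitive_part)
  have deg: "degree f = degree g" by (simp add: g(1))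
  obtain t where t: "v = t \<bullet> ([:fps_X:] \<bullet> v)" using v_in_cyclic[OF act_closed[OF v(1)] Xv] by blast
  obtain s where s: "t \<star> [:fps_X:] = [:fps_X:] \<star> s" by (rule skew_X)
  obtain r where r: "s \<star> [:fps_X ^ n:] = smult (fps_X ^ n) r"
    using skew_X_power[of s n] by metis
  then have r: "s \<star> [:fps_X ^ n:] = [:fps_X ^ n:] \<star> r" by (simp only: const_skew)
  have comm: "[:fps_X:] \<star> [:fps_X ^ n:] = [:fps_X ^ n:] \<star> [:fps_X:]"
    by (simp add: const_skew mult.commute)
  have "([:fps_X:] \<star> s) \<star> [:fps_X ^ n:] = ([:fps_X:] \<star> [:fps_X ^ n:]) \<star> r"
    by (simp only: skew_assoc r)
  also have "\<dots> = [:fps_X ^ n:] \<star> ([:fps_X:] \<star> r)" unfolding comm by (rule skew_assoc)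
  finally have Xr: "([:fps_X:] \<star> s) \<star> [:fps_X ^ n:] = [:fps_X ^ n:] \<star> ([:fps_X:] \<star> r)" .
  have gy: "g \<bullet> y \<in> carrier E" using y(1) by simp
  have "f = [:fps_X ^ n:] \<star> g" by (simp only: g(1) const_skew)
  then have vg: "[:fps_X ^ n:] \<bullet> (g \<bullet> y) = v" using y by (simp only: act_skew)
  have "v = ([:fps_X:] \<star> s) \<bullet> v" unfolding s[symmetric] act_skew[OF v(1)] by (rule t)
  then have "[:fps_X ^ n:] \<bullet> (g \<bullet> y) = ([:fps_X:] \<star> s) \<bullet> ([:fps_X ^ n:] \<bullet> (g \<bullet> y))"
    unfolding vg .
  also have "\<dots> = ([:fps_X ^ n:] \<star> ([:fps_X:] \<star> r)) \<bullet> (g \<bullet> y)"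
    using gy by (simp only: Xr flip: act_skew)
  finally have "[:fps_X ^ n:] \<bullet> (g \<bullet> y) = ([:fps_X ^ n:] \<star> ([:fps_X:] \<star> r)) \<bullet> (g \<bullet> y)" .
  then have "([:fps_X ^ n:] \<star> (1 - [:fps_X:] \<star> r)) \<bullet> (g \<bullet> y) = \<zero>\<^sub>E"
    using gy by (simp only: skew_diff_right act_diff_eq_0_iff skew_1_right)
  then have "[:fps_X ^ n:] \<bullet> ((1 - [:fps_X:] \<star> r) \<bullet> (g \<bullet> y)) = \<zero>\<^sub>E"
    using gy by (simp only: act_skew)
  then have "(1 - [:fps_X:] \<star> r) \<bullet> (g \<bullet> y) = \<zero>\<^sub>E"
    by (rule X_injective[OF Xv act_closed[OF gy]])
  moreover define h where "h = (1 - [:fps_X:] \<star> r) \<star> g"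
  ultimately have h: "h \<bullet> y = \<zero>\<^sub>E" using y(1) by (simp add: act_skew)
  have h_coeff: "coeff h j $ 0 = coeff g j $ 0" for j
    by (simp add: h_def skew_diff_left const_skew skew_smult_left)
  define D where "D = {j. coeff g j $ 0 \<noteq> 0}"
  have D: "D \<subseteq> {..degree g}" by (auto simp: D_def intro: le_degree)
  then have fin: "finite D" by (rule finite_subset) simp
  have "D \<noteq> {}" using g(2) by (auto simp: D_def)
  then have d: "Max D \<in> D" "\<And>j. j > Max D \<Longrightarrow> j \<notin> D"
    using fin by (auto dest: Max_ge)
  obtain w u where wu: "h = w \<star> u" "degree w = Max D" "lead_coeff w $ 0 \<noteq> 0" "[:fps_X:] dvd u - 1"
  proof (rule hensel_factorization[of h "Max D"])
    show "coeff h (Max D) $ 0 \<noteq> 0" using d(1) unfolding h_coeff D_def by blast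
    show "coeff h j $ 0 = 0" if "j > Max D" for j using d(2)[OF that] unfolding h_coeff D_def by blast
  qed
  have "degree w \<le> degree f" using d(1) D by (auto simp: wu deg)
  moreover have "w \<bullet> (u \<bullet> y) = \<zero>\<^sub>E" using h y(1) by (simp add: wu(1) act_skew)
  ultimately show ?thesis using that wu(3,4) by blast
qed

text \<open>
  Over a discrete valuation ring, a submodule \<open>S y\<close> with such an annihilator would be finitely
  generated over the power series ring; \<open>X\<close> is surjective on the simple module inside it, which
  contradicts Nakayama's lemma. Here this is carried out by descent on the degree of \<open>w\<close>.
  Dividing by \<open>w\<close> yields \<open>f\<close> of smaller degree with \<open>f y = v\<close>. The factor \<open>w1\<close> obtained from \<open>f\<close> then has a
  smaller degree than \<open>w\<close> too, so by induction it can kill \<open>u y\<close> only if \<open>u y = 0\<close>.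
  Now \<open>\<theta>\<^sup>d\<close> times \<open>u\<close>, reduced by \<open>w\<close> where \<open>w\<close> has degree \<open>d + 1\<close>, is a polynomial of degree \<open>d\<close> with a
  unit leading coefficient that kills \<open>y\<close>.
\<close>

lemma no_unit_lead_annihilator:
  assumes Xv: "[:fps_X:] \<bullet> v \<noteq> \<zero>\<^sub>E"
    and "y \<in> carrier E" "lead_coeff w $ 0 \<noteq> 0" "w \<bullet> y = \<zero>\<^sub>E"
  shows "y = \<zero>\<^sub>E"
  using assms(2-4)
proof (induction "degree w" arbitrary: w y rule: less_induct)
  case less
  note y = less.prems(1) and w = less.prems(2,3)
  show ?case
  proof (rule ccontr)
    assume "y \<noteq> \<zero>\<^sub>E"
    then obtain f0 where f0: "v = f0 \<bullet> y" using v_in_cyclic y by blast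
    obtain q where q: "\<And>i. i \<ge> degree w \<Longrightarrow> coeff (f0 - q \<star> w) i = 0"
      using skew_division[OF w(1)] by blast
    define f where "f = f0 - q \<star> w"
    have "(f0 - f) \<bullet> y = \<zero>\<^sub>E" using y w(2) by (simp add: f_def act_skew)
    then have fy: "f \<bullet> y = v" using y f0 by (simp add: act_diff_eq_0_iff)
    then have "f \<noteq> 0" using v(2) y by auto
    then have "lead_coeff f \<noteq> 0" by simp
    then have deg_f: "degree f < degree w" using q not_le unfolding f_def by blast
    obtain w1 u where w1: "lead_coeff w1 $ 0 \<noteq> 0" "degree w1 \<le> degree f"
        "[:fps_X:] dvd u - 1" "w1 \<bullet> (u \<bullet> y) = \<zero>\<^sub>E"
      using Xv y fy by (rule annihilator_factorization)
    have uy: "u \<bullet> y = \<zero>\<^sub>E"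
      using less.hyps[of w1 "u \<bullet> y"] w1 deg_f y by simp
    obtain d where d: "degree w = Suc d" using deg_f by (cases "degree w") auto
    \<comment> \<open>\<open>\<theta>\<^sup>d (u - 1)\<close> is \<open>X r\<close>; dividing \<open>r\<close> by \<open>w\<close> lowers its degree.\<close>
    let ?m = "monom 1 d :: 'a fps poly"
    have "[:fps_X ^ 1:] dvd ?m \<star> (u - 1)" using w1(3) by (intro X_power_dvd_skew_right) simp
    then have "[:fps_X:] dvd ?m \<star> (u - 1)" by simp
    then obtain r where r: "?m \<star> (u - 1) = [:fps_X:] \<star> r" by (rule X_dvdE)
    obtain q' where q': "\<And>i. i \<ge> degree w \<Longrightarrow> coeff (r - q' \<star> w) i = 0"
      using skew_division[OF w(1)] by blast
    define g where "g = ?m + [:fps_X:] \<star> (r - q' \<star> w)"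
    have "g = ?m \<star> u - ([:fps_X:] \<star> q') \<star> w"
      using r by (simp add: g_def skew_diff_right skew_assoc algebra_simps)
    then have gy: "g \<bullet> y = \<zero>\<^sub>E" using y uy w(2) by (simp add: act_diff_eq_0_iff act_skew)
    have gd: "coeff g d $ 0 \<noteq> 0" by (simp add: g_def const_skew)
    have "coeff g i = 0" if "i > d" for i using that q'[of i] by (simp add: g_def const_skew d)
    then have "degree g \<le> d" by (intro degree_le) auto
    moreover have "d \<le> degree g" using gd by (intro le_degree) auto
    ultimately have "degree g = d" by simp
    then show False using less.hyps[of g y] gd gy y d \<open>y \<noteq> \<zero>\<^sub>E\<close> by simp
  qed
qed

lemma X_divisible_annihilator:
  assumes Xv: "[:fps_X:] \<bullet> v \<noteq> \<zero>\<^sub>E" and x: "x \<in> carrier E"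
  shows "\<exists>u. [:fps_X:] dvd u - 1 \<and> u \<bullet> x = \<zero>\<^sub>E"
proof (cases "x = \<zero>\<^sub>E")
  case True
  then show ?thesis by (intro exI[of _ 1]) simp
next
  case False
  then obtain f where "v = f \<bullet> x" using v_in_cyclic[OF x] by blast
  then have f: "f \<bullet> x = v" by simp
  obtain w u where "lead_coeff w $ 0 \<noteq> 0" "[:fps_X:] dvd u - 1" "w \<bullet> (u \<bullet> x) = \<zero>\<^sub>E"
    using Xv x f by (rule annihilator_factorization)
  then show ?thesis using no_unit_lead_annihilator[OF Xv, of "u \<bullet> x" w] x by auto
qed

text \<open>
  An element \<open>y\<close> killed by \<open>1 + s X\<close> equals \<open>- s X y\<close>. So a submodule that contains \<open>X y\<close> contains \<open>y\<close>,
  and the left ideals that describe the submodules of \<open>S x\<close> are closed under division by \<open>X\<close>.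
\<close>

lemma dcc_cyclic_X_divisible:
  assumes x: "x \<in> carrier E" and Xv: "[:fps_X:] \<bullet> v \<noteq> \<zero>\<^sub>E"
  shows "dcc_below (range (\<lambda>s. s \<bullet> x))"
  unfolding dcc_below_def
proof (intro allI impI)
  fix N :: "nat \<Rightarrow> 'b set"
  assume "\<forall>n. submodule (N n) (skew_poly_ring \<alpha>) E \<and> N n \<subseteq> range (\<lambda>s. s \<bullet> x) \<and> N (Suc n) \<subseteq> N n"
  then have N: "\<And>n. submodule (N n) (skew_poly_ring \<alpha>) E" "\<And>n. N n \<subseteq> range (\<lambda>s. s \<bullet> x)"
    "\<And>n. N (Suc n) \<subseteq> N n" by blast+
  have sat: "y \<in> N n" if "y \<in> carrier E" "[:fps_X:] \<bullet> y \<in> N n" for y n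
  proof -
    obtain u where u: "[:fps_X:] dvd u - 1" "u \<bullet> y = \<zero>\<^sub>E"
      using X_divisible_annihilator[OF Xv \<open>y \<in> carrier E\<close>] by blast
    obtain r where r: "u - 1 = [:fps_X:] \<star> r" using u(1) by (rule X_dvdE)
    obtain s where s: "[:fps_X:] \<star> r = s \<star> [:fps_X:]" by (rule X_skew)
    have "(u - (1 + s \<star> [:fps_X:])) = 0" using r s by (simp add: algebra_simps)
    then have "u = 1 + s \<star> [:fps_X:]" by simp
    then have "y \<oplus>\<^bsub>E\<^esub> s \<bullet> ([:fps_X:] \<bullet> y) = \<zero>\<^sub>E"
      using u(2) that(1) by (simp add: act_add act_skew)
    then have "y = \<ominus>\<^bsub>E\<^esub> (s \<bullet> ([:fps_X:] \<bullet> y))" using that(1) by (simp add: M.minus_equality)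
    also have "\<dots> = \<zero>\<^sub>E \<ominus>\<^bsub>E\<^esub> s \<bullet> ([:fps_X:] \<bullet> y)" using that(1) by (simp add: a_minus_def)
    also have "\<dots> \<in> N n"
      using N(1)[of n] that(2) by (intro submodule_diff) (auto simp: submodule_iff)
    finally show ?thesis .
  qed
  obtain u where u: "[:fps_X:] dvd u - 1" "u \<bullet> x = \<zero>\<^sub>E"
    using X_divisible_annihilator[OF Xv x] by blast
  have "fps_X dvd coeff (u - 1) 0" using u(1) unfolding const_poly_dvd_iff by blast
  then have "u \<noteq> 0" by (auto simp: X_dvd_nth)
  have "\<exists>m. \<forall>n\<ge>m. {s. s \<bullet> x \<in> N n} = {s. s \<bullet> x \<in> N m}"
  proof (rule left_ideal_saturated_dcc[of _ u])
    show "left_ideal {s. s \<bullet> x \<in> N n}" for n by (intro left_ideal_preimage N x)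
    show "{s. s \<bullet> x \<in> N (Suc n)} \<subseteq> {s. s \<bullet> x \<in> N n}" for n using N(3)[of n] by blast
    show "u \<in> {s. s \<bullet> x \<in> N n}" for n using N(1)[of n] u(2) by (simp add: submodule_iff)
    show "f \<in> {s. s \<bullet> x \<in> N n}" if "smult fps_X f \<in> {s. s \<bullet> x \<in> N n}" for f n
      using sat[of "f \<bullet> x" n] that x by (simp add: const_skew flip: act_skew)
  qed fact
  with N(2) show "\<exists>m. \<forall>n\<ge>m. N n = N m" by (rule stable_if_preimage_stable)
qed

theorem locally_artinian: "locally_artinian (skew_poly_ring \<alpha>) E"
  using dcc_cyclic_X_torsion dcc_cyclic_X_divisible
  by (intro locally_artinianI left_module_axioms) auto

end

section \<open>Restriction of scalars and the opposite ring\<close>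

definition restrict_scalars :: "('s \<Rightarrow> 'r) \<Rightarrow> ('r, 'b) module \<Rightarrow> ('s, 'b) module" where
  "restrict_scalars \<phi> M = \<lparr>carrier = carrier M, monoid.mult = monoid.mult M, one = one M,
     zero = zero M, add = add M, module.smult = (\<lambda>a x. \<phi> a \<odot>\<^bsub>M\<^esub> x)\<rparr>"

lemma restrict_scalars_simps [simp]:
  "carrier (restrict_scalars \<phi> M) = carrier M"
  "\<zero>\<^bsub>restrict_scalars \<phi> M\<^esub> = \<zero>\<^bsub>M\<^esub>"
  "x \<oplus>\<^bsub>restrict_scalars \<phi> M\<^esub> y = x \<oplus>\<^bsub>M\<^esub> y"
  "a \<odot>\<^bsub>restrict_scalars \<phi> M\<^esub> x = \<phi> a \<odot>\<^bsub>M\<^esub> x"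
  "restrict_scalars \<phi> (M\<lparr>carrier := H\<rparr>) = restrict_scalars \<phi> M\<lparr>carrier := H\<rparr>"
  by (simp_all add: restrict_scalars_def)

locale surjective_ring_hom =
  fixes S :: "('s, 'c) ring_scheme" and R :: "('r, 'd) ring_scheme" and \<phi>
  assumes ring: "ring S" and hom: "\<phi> \<in> ring_hom S R" and surj: "\<phi> ` carrier S = carrier R"
begin

lemma left_module_restrict_scalars:
  assumes "left_module R M"
  shows "left_module S (restrict_scalars \<phi> M)"
proof -
  interpret left_module R M by fact
  have "abelian_group (restrict_scalars \<phi> M)"
    by (rule abelian_groupI) (auto simp: M.a_ac intro: bexI[of _ "\<ominus>\<^bsub>M\<^esub> _"] M.l_neg)
  then show ?thesis
    using ring ring_hom_closed[OF hom] ring_hom_add[OF hom] ring_hom_mult[OF hom] ring_hom_one[OF hom]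
    by (intro left_module.intro left_module_axioms.intro)
      (auto simp: smult_l_distr smult_r_distr smult_assoc)
qed

lemma submodule_restrict_scalars_iff:
  assumes "left_module R M"
  shows "submodule N S (restrict_scalars \<phi> M) \<longleftrightarrow> submodule N R M"
  using left_module.submodule_iff[OF assms]
    left_module.submodule_iff[OF left_module_restrict_scalars[OF assms]]
  by (simp flip: surj)

lemma noetherian_module_restrict_scalars:
  assumes "left_module R M" "noetherian_module S (restrict_scalars \<phi> M)"
  shows "noetherian_module R M"
  using assms by (simp add: noetherian_module_def submodule_restrict_scalars_iff)

lemma locally_artinian_restrict_scalars:
  assumes M: "left_module R M" and artin: "locally_artinian S (restrict_scalars \<phi> M)"
  shows "locally_artinian R M"
proof -
  interpret left_module R M by fact
  have "artinian_module R (M\<lparr>carrier := submodule_span R M F\<rparr>)"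
    if F: "finite F" "F \<subseteq> carrier M" for F
  proof -
    let ?L = "submodule_span R M F"
    have span: "submodule_span S (restrict_scalars \<phi> M) F = ?L"
      by (simp add: submodule_span_def submodule_restrict_scalars_iff M)
    have "submodule ?L R M" using M F(2) by (rule submodule_submodule_span)
    then have L: "left_module R (M\<lparr>carrier := ?L\<rparr>)"
      by (intro submodule_left_moduleI) (auto simp: submodule_iff)
    have "artinian_module S
        (restrict_scalars \<phi> M\<lparr>carrier := submodule_span S (restrict_scalars \<phi> M) F\<rparr>)"
      using artin F unfolding locally_artinian_def by simp
    then have "artinian_module S (restrict_scalars \<phi> (M\<lparr>carrier := ?L\<rparr>))"
      by (simp add: span)
    then show ?thesis
      using L by (simp add: artinian_module_def submodule_restrict_scalars_iff[OF L]
          del: restrict_scalars_simps(5))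
  qed
  then show ?thesis using M unfolding locally_artinian_def by blast
qed

end

context fps_automorphism
begin

text \<open>
  The polynomial whose coefficients \<open>a\<^sub>i\<close> are to be written on the right, that is, the sum of the
  \<open>\<theta>\<^sup>i a\<^sub>i = \<alpha>\<^sup>i(a\<^sub>i) \<theta>\<^sup>i\<close>. In the opposite ring \<open>\<theta>\<^sup>i a\<^sub>i\<close> is the product of \<open>a\<^sub>i\<close> and \<open>\<theta>\<^sup>i\<close> in this
  order, and \<open>\<theta>\<close> commutes past coefficients through the inverse of \<open>\<alpha>\<close>.
\<close>

definition coeff_twist :: "'k fps poly \<Rightarrow> 'k fps poly" where
  "coeff_twist p = (\<Sum>i\<le>degree p. monom ((\<alpha> ^^ i) (coeff p i)) i)"

lemma coeff_coeff_twist: "coeff (coeff_twist p) i = (\<alpha> ^^ i) (coeff p i)"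
  by (simp add: coeff_twist_def coeff_sum coeff_eq_0)

lemma pow_alpha_add: "(\<alpha> ^^ i) (f + g) = (\<alpha> ^^ i) f + (\<alpha> ^^ i) g"
  by (induction i) (simp_all add: alpha_add)

lemma pow_alpha_mult: "(\<alpha> ^^ i) (f * g) = (\<alpha> ^^ i) f * (\<alpha> ^^ i) g"
  by (induction i) (simp_all add: alpha_mult)

lemma pow_alpha_sum: "(\<alpha> ^^ i) (sum f A) = (\<Sum>a\<in>A. (\<alpha> ^^ i) (f a))"
  by (induction A rule: infinite_finite_induct) (simp_all add: pow_alpha_add)

lemma pow_alpha_pow_inv:
  assumes "i \<le> n"
  shows "(\<alpha> ^^ n) ((inv_into UNIV \<alpha> ^^ i) f) = (\<alpha> ^^ (n - i)) f"
proof -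
  have "\<alpha> (inv_into UNIV \<alpha> g) = g" for g by (rule surj_f_inv_f[OF bij_is_surj[OF bij_alpha]])
  then have "(\<alpha> ^^ i) ((inv_into UNIV \<alpha> ^^ i) f) = f"
    by (induction i arbitrary: f) (simp_all add: funpow_swap1)
  then have "(\<alpha> ^^ (n - i + i)) ((inv_into UNIV \<alpha> ^^ i) f) = (\<alpha> ^^ (n - i)) f"
    by (simp only: funpow_add o_apply)
  with assms show ?thesis by simp
qed

lemma coeff_twist_skew:
  "coeff_twist (skew_times (inv_into UNIV \<alpha>) p q) = coeff_twist q \<star> coeff_twist p"
proof (rule poly_eqI)
  fix n
  interpret inv: fps_automorphism "inv_into UNIV \<alpha>" by (rule fps_automorphism_inv)
  have "coeff (coeff_twist (skew_times (inv_into UNIV \<alpha>) p q)) n =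
      (\<Sum>i\<le>n. (\<alpha> ^^ n) (coeff p i) * (\<alpha> ^^ (n - i)) (coeff q (n - i)))"
    by (simp add: coeff_coeff_twist inv.coeff_skew pow_alpha_sum pow_alpha_mult pow_alpha_pow_inv)
  also have "\<dots> = (\<Sum>j\<le>n. (\<alpha> ^^ j) (coeff q j) * (\<alpha> ^^ n) (coeff p (n - j)))"
    by (rule sum.reindex_bij_witness[of _ "\<lambda>i. n - i" "\<lambda>i. n - i"]) (auto simp: mult.commute)
  also have "\<dots> = coeff (coeff_twist q \<star> coeff_twist p) n"
    unfolding coeff_skew coeff_coeff_twist
  proof (rule sum.cong)
    fix j assume "j \<in> {..n}"
    then have "(\<alpha> ^^ j) ((\<alpha> ^^ (n - j)) f) = (\<alpha> ^^ n) f" for f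
      by (simp flip: funpow_add o_apply[of "\<alpha> ^^ j"])
    then show "(\<alpha> ^^ j) (coeff q j) * (\<alpha> ^^ n) (coeff p (n - j)) =
        (\<alpha> ^^ j) (coeff q j) * (\<alpha> ^^ j) ((\<alpha> ^^ (n - j)) (coeff p (n - j)))" by simp
  qed simp
  finally show "coeff (coeff_twist (skew_times (inv_into UNIV \<alpha>) p q)) n =
      coeff (coeff_twist q \<star> coeff_twist p) n" .
qed

lemma surj_coeff_twist: "range coeff_twist = UNIV"
proof -
  have "\<exists>p. q = coeff_twist p" for q
  proof -
    define f where "f i = (SOME g. (\<alpha> ^^ i) g = coeff q i)" for i
    have f: "(\<alpha> ^^ i) (f i) = coeff q i" for i
      unfolding f_def by (rule someI_ex[OF surj_pow_alpha])
    have "f i = 0" if "i > degree q" for i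
      using f[of i] that by (simp add: coeff_eq_0 pow_alpha_eq_0_iff)
    then obtain p where "\<And>i. coeff p i = f i" by (rule poly_of_coeffs) blast+
    then have "q = coeff_twist p" by (intro poly_eqI) (simp add: coeff_coeff_twist f)
    then show ?thesis ..
  qed
  then show ?thesis by blast
qed

lemma surjective_ring_hom_coeff_twist:
  "surjective_ring_hom (skew_poly_ring (inv_into UNIV \<alpha>)) (opposite_ring (skew_poly_ring \<alpha>))
     coeff_twist"
proof -
  interpret inv: fps_automorphism "inv_into UNIV \<alpha>" by (rule fps_automorphism_inv)
  have "coeff_twist (p + q) = coeff_twist p + coeff_twist q" for p q
    by (rule poly_eqI) (simp add: coeff_coeff_twist pow_alpha_add)
  moreover have "coeff_twist 1 = 1"
    by (rule poly_eqI) (simp add: coeff_coeff_twist)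
  ultimately have "coeff_twist \<in>
      ring_hom (skew_poly_ring (inv_into UNIV \<alpha>)) (opposite_ring (skew_poly_ring \<alpha>))"
    by (intro ring_hom_memI) (simp_all add: coeff_twist_skew)
  then show ?thesis
    by (intro surjective_ring_hom.intro inv.ring_skew) (simp_all add: surj_coeff_twist)
qed

end

section \<open>Essential extensions of simple modules\<close>

text \<open>
  The image of the simple module meets each nonzero \<open>S x\<close>, and by simplicity it is then contained
  in \<open>S x\<close>.
\<close>

lemma essential_simple_monolith:
  assumes simple: "simple_module R M" and E: "left_module R E"
    and \<iota>: "\<iota> \<in> module_hom R M E" "inj_on \<iota> (carrier M)"
    and ess: "essential_submodule R E (\<iota> ` carrier M)"
  obtains v where "v \<in> carrier E" "v \<noteq> \<zero>\<^bsub>E\<^esub>"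
    "\<forall>x\<in>carrier E. x \<noteq> \<zero>\<^bsub>E\<^esub> \<longrightarrow> (\<exists>s\<in>carrier R. v = s \<odot>\<^bsub>E\<^esub> x)"
proof -
  interpret M: left_module R M using simple by (simp add: simple_module_def)
  interpret E: left_module R E by fact
  have \<iota>_closed: "\<iota> x \<in> carrier E" if "x \<in> carrier M" for x
    using \<iota>(1) that by (auto simp: module_hom_def)
  have \<iota>_add: "\<iota> (x \<oplus>\<^bsub>M\<^esub> y) = \<iota> x \<oplus>\<^bsub>E\<^esub> \<iota> y" if "x \<in> carrier M" "y \<in> carrier M" for x y
    using \<iota>(1) that by (auto simp: module_hom_def)
  have \<iota>_smult: "\<iota> (a \<odot>\<^bsub>M\<^esub> x) = a \<odot>\<^bsub>E\<^esub> \<iota> x" if "a \<in> carrier R" "x \<in> carrier M" for a x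
    using \<iota>(1) that by (auto simp: module_hom_def)
  have \<iota>_0: "\<iota> \<zero>\<^bsub>M\<^esub> = \<zero>\<^bsub>E\<^esub>"
    using \<iota>_smult[of "\<zero>\<^bsub>R\<^esub>" "\<zero>\<^bsub>M\<^esub>"] \<iota>_closed[of "\<zero>\<^bsub>M\<^esub>"] by simp
  have "carrier M \<noteq> {\<zero>\<^bsub>M\<^esub>}" using simple by (simp add: simple_module_def)
  then obtain m where m: "m \<in> carrier M" "m \<noteq> \<zero>\<^bsub>M\<^esub>" by blast
  show ?thesis
  proof (rule that[of "\<iota> m"]; (intro ballI impI)?)
    show "\<iota> m \<in> carrier E" using m(1) by (rule \<iota>_closed)
    show "\<iota> m \<noteq> \<zero>\<^bsub>E\<^esub>"
      using inj_onD[OF \<iota>(2), of m "\<zero>\<^bsub>M\<^esub>"] m by (auto simp: \<iota>_0)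
    fix x assume x: "x \<in> carrier E" "x \<noteq> \<zero>\<^bsub>E\<^esub>"
    note c = E.submodule_cyclic[OF x(1)]
    have "E.cyclic x \<noteq> {\<zero>\<^bsub>E\<^esub>}" using c(2) x(2) by blast
    then have "\<iota> ` carrier M \<inter> E.cyclic x \<noteq> {\<zero>\<^bsub>E\<^esub>}"
      using ess c(1) by (simp add: essential_submodule_def)
    moreover have "\<zero>\<^bsub>E\<^esub> \<in> \<iota> ` carrier M \<inter> E.cyclic x"
      using c(1) \<iota>_0 by (auto simp: E.submodule_iff intro: rev_image_eqI[of "\<zero>\<^bsub>M\<^esub>"])
    ultimately obtain m' where m': "m' \<in> carrier M" "\<iota> m' \<in> E.cyclic x" "\<iota> m' \<noteq> \<zero>\<^bsub>E\<^esub>" by blast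
    define P where "P = {y \<in> carrier M. \<iota> y \<in> E.cyclic x}"
    have "submodule P R M"
      using c(1) by (auto simp: P_def M.submodule_iff E.submodule_iff \<iota>_0 \<iota>_add \<iota>_smult)
    moreover have "m' \<in> P" "m' \<noteq> \<zero>\<^bsub>M\<^esub>" using m' \<iota>_0 by (auto simp: P_def)
    then have "P \<noteq> {\<zero>\<^bsub>M\<^esub>}" by blast
    ultimately have "P = carrier M" using simple by (auto simp: simple_module_def)
    then have "\<iota> m \<in> E.cyclic x" using m(1) by (auto simp: P_def)
    then show "\<exists>s\<in>carrier R. \<iota> m = s \<odot>\<^bsub>E\<^esub> x" by auto
  qed
qed

context fps_automorphism
begin

lemma locally_artinian_if_monolith:
  assumes "left_module (skew_poly_ring \<alpha>) E" and v: "v \<in> carrier E" "v \<noteq> \<zero>\<^bsub>E\<^esub>"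
    "\<And>x. x \<in> carrier E \<Longrightarrow> x \<noteq> \<zero>\<^bsub>E\<^esub> \<Longrightarrow> \<exists>s. v = s \<odot>\<^bsub>E\<^esub> x"
  shows "locally_artinian (skew_poly_ring \<alpha>) E"
proof -
  interpret left_module "skew_poly_ring \<alpha>" E by fact
  interpret monolithic_skew_poly_module \<alpha> E v by unfold_locales (use v in auto)
  show ?thesis by (rule locally_artinian)
qed

text \<open>
  Stated for cyclic modules rather than for the ring itself, so that it also covers the opposite ring,
  which is cyclic as a module over the skew polynomial ring of the inverse automorphism.
\<close>

lemma noetherian_module_if_cyclic:
  assumes "left_module (skew_poly_ring \<alpha>) E" "x \<in> carrier E" "carrier E = range (\<lambda>s. s \<odot>\<^bsub>E\<^esub> x)"
  shows "noetherian_module (skew_poly_ring \<alpha>) E"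
proof -
  interpret left_module "skew_poly_ring \<alpha>" E by fact
  interpret skew_poly_module \<alpha> E by unfold_locales
  have "\<exists>m. \<forall>n\<ge>m. N n = N m"
    if N: "\<And>n. submodule (N n) (skew_poly_ring \<alpha>) E" "\<And>n. N n \<subseteq> N (Suc n)" for N :: "nat \<Rightarrow> 'a set"
    using N(1) assms(3)
    by (intro submodule_acc[OF assms(2)] N) (auto simp: submodule_iff)
  then show ?thesis using assms(1) unfolding noetherian_module_def by blast
qed

lemma noetherian_ring_skew_poly_ring: "noetherian_ring (skew_poly_ring \<alpha>)"
proof -
  let ?S = "skew_poly_ring \<alpha>"
  interpret inv: fps_automorphism "inv_into UNIV \<alpha>" by (rule fps_automorphism_inv)
  interpret twist: surjective_ring_hom "skew_poly_ring (inv_into UNIV \<alpha>)" "opposite_ring ?S" coeff_twist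
    by (rule surjective_ring_hom_coeff_twist)
  have left: "noetherian_module ?S (regular_module ?S)"
    by (rule noetherian_module_if_cyclic[of _ 1])
      (simp_all add: left_module_regular_module ring_skew)
  have M: "left_module (opposite_ring ?S) (regular_module (opposite_ring ?S))"
    by (intro left_module_regular_module ring_opposite_ring ring_skew)
  have "noetherian_module (skew_poly_ring (inv_into UNIV \<alpha>))
      (restrict_scalars coeff_twist (regular_module (opposite_ring ?S)))"
    by (rule inv.noetherian_module_if_cyclic[of _ 1])
      (simp_all add: twist.left_module_restrict_scalars M surj_coeff_twist)
  then have "noetherian_module (opposite_ring ?S) (regular_module (opposite_ring ?S))"
    by (rule twist.noetherian_module_restrict_scalars[OF M])
  with left show ?thesis unfolding noetherian_ring_def by blast
qed

end

theorem corollary6p12: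
  fixes \<alpha> :: "'k::field fps \<Rightarrow> 'k fps"
  assumes "fps_algebra_automorphism \<alpha>"
  shows "diamond TYPE('m) TYPE('e) (skew_poly_ring \<alpha>)"
proof -
  interpret fps_automorphism \<alpha> by (rule fps_automorphism.intro) fact
  interpret inv: fps_automorphism "inv_into UNIV \<alpha>" by (rule fps_automorphism_inv)
  let ?S = "skew_poly_ring \<alpha>"
  interpret twist: surjective_ring_hom "skew_poly_ring (inv_into UNIV \<alpha>)" "opposite_ring ?S" coeff_twist
    by (rule surjective_ring_hom_coeff_twist)
  have left: "locally_artinian ?S E"
    if simple: "simple_module ?S M" and hull: "injective_hull ?S M E \<iota>"
    for M :: "('k fps poly, 'm) module" and E :: "('k fps poly, 'e) module" and \<iota>
  proof -
    have E: "left_module ?S E" using hull by (simp add: injective_hull_def injective_module_def)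
    have \<iota>: "\<iota> \<in> module_hom ?S M E" "inj_on \<iota> (carrier M)"
      "essential_submodule ?S E (\<iota> ` carrier M)"
      using hull by (simp_all add: injective_hull_def)
    obtain v where "v \<in> carrier E" "v \<noteq> \<zero>\<^bsub>E\<^esub>"
      "\<forall>x\<in>carrier E. x \<noteq> \<zero>\<^bsub>E\<^esub> \<longrightarrow> (\<exists>s\<in>carrier ?S. v = s \<odot>\<^bsub>E\<^esub> x)"
      by (rule essential_simple_monolith[OF simple E \<iota>])
    then show ?thesis using E by (intro locally_artinian_if_monolith) auto
  qed
  have right: "locally_artinian (opposite_ring ?S) E"
    if simple: "simple_module (opposite_ring ?S) M" and hull: "injective_hull (opposite_ring ?S) M E \<iota>"
    for M :: "('k fps poly, 'm) module" and E :: "('k fps poly, 'e) module" and \<iota>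
  proof -
    have E: "left_module (opposite_ring ?S) E"
      using hull by (simp add: injective_hull_def injective_module_def)
    have \<iota>: "\<iota> \<in> module_hom (opposite_ring ?S) M E" "inj_on \<iota> (carrier M)"
      "essential_submodule (opposite_ring ?S) E (\<iota> ` carrier M)"
      using hull by (simp_all add: injective_hull_def)
    obtain v where v: "v \<in> carrier E" "v \<noteq> \<zero>\<^bsub>E\<^esub>"
      "\<forall>x\<in>carrier E. x \<noteq> \<zero>\<^bsub>E\<^esub> \<longrightarrow> (\<exists>s\<in>carrier (opposite_ring ?S). v = s \<odot>\<^bsub>E\<^esub> x)"
      by (rule essential_simple_monolith[OF simple E \<iota>])
    have "\<exists>s. v = coeff_twist s \<odot>\<^bsub>E\<^esub> x" if x: "x \<in> carrier E" "x \<noteq> \<zero>\<^bsub>E\<^esub>" for x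
    proof -
      obtain t where t: "v = t \<odot>\<^bsub>E\<^esub> x" using v(3) x by blast
      have "t \<in> range coeff_twist" by (simp add: surj_coeff_twist)
      then show ?thesis using t by blast
    qed
    then have "locally_artinian (skew_poly_ring (inv_into UNIV \<alpha>)) (restrict_scalars coeff_twist E)"
      using v(1,2) by (intro inv.locally_artinian_if_monolith[of _ v] twist.left_module_restrict_scalars E) simp_all
    then show ?thesis by (rule twist.locally_artinian_restrict_scalars[OF E])
  qed
  show ?thesis
    unfolding diamond_def using ring_skew noetherian_ring_skew_poly_ring left right by blast
qed

end
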